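(* Let $G$ be the first Grigorchuk group and let $K=\langle (ab)^2\rangle^G$ be the normal closure of $(ab)^2$ in $G$ (its branching subgroup). Then $G$ has commutator width $2$, and $K$ has commutator width $2$.
   Context: The commutator width of a group $\Gamma$ is the least $n\in\mathbb N\cup\{\infty\}$ such that every element of the derived subgroup $\Gamma'=[\Gamma,\Gamma]$ is a product of $n$ commutators of elements of $\Gamma$. An automorphism $g$ of the rooted binary tree $T_2$ is identified with $\langle\!\langle g_1,g_2\rangle\!\rangle\sigma\in \mathrm{Aut}(T_2)\wr S_2$, where $\sigma\in S_2$ is its action on the two subtrees below the root and $g_1,g_2\in\mathrm{Aut}(T_2)$ are its states; multiplication is $\langle\!\langle g_1,g_2\rangle\!\rangle\sigma\cdot\langle\!\langle h_1,h_2\rangle\!\rangle\tau=\langle\!\langle g_1h_{1^\sigma},g_2h_{2^\sigma}\rangle\!\rangle\sigma\tau$. The first Grigorchuk group $G$ is the subgroup of $\mathrm{Aut}(T_2)$ generated by $a,b,c,d$, defined recursively by $a=\langle\!\langle 1,1\rangle\!\rangle(1,2)$, $b=\langle\!\langle a,c\rangle\!\rangle$, $c=\langle\!\langle a,d\rangle\!\rangle$, $d=\langle\!\langle 1,b\rangle\!\rangle$. *)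

theory Defs
  imports "HOL-Algebra.Algebra" "HOL-Library.Extended_Nat"
begin

text \<open>
  Commutators are those of \<open>derived_set\<close>, that is \<open>x y x\<^sup>-\<^sup>1 y\<^sup>-\<^sup>1\<close>; the other usual convention
  \<open>x\<^sup>-\<^sup>1 y\<^sup>-\<^sup>1 x y\<close> gives the same set of commutators of a group.
\<close>

definition commutator_products :: "('a, 'b) monoid_scheme \<Rightarrow> nat \<Rightarrow> 'a set" where
  "commutator_products \<Gamma> n =
     {foldr (\<otimes>\<^bsub>\<Gamma>\<^esub>) cs \<one>\<^bsub>\<Gamma>\<^esub> | cs. length cs = n \<and> set cs \<subseteq> derived_set \<Gamma> (carrier \<Gamma>)}"

text \<open>In \<open>enat\<close> the infimum of a nonempty set is its least element, and \<open>Inf {} = \<infinity>\<close>.\<close>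

definition commutator_width :: "('a, 'b) monoid_scheme \<Rightarrow> enat" where
  "commutator_width \<Gamma> =
     Inf {enat n | n. derived \<Gamma> (carrier \<Gamma>) \<subseteq> commutator_products \<Gamma> n}"

definition normal_closure :: "('a, 'b) monoid_scheme \<Rightarrow> 'a set \<Rightarrow> 'a set" where
  "normal_closure \<Gamma> S =
     generate \<Gamma> {g \<otimes>\<^bsub>\<Gamma>\<^esub> s \<otimes>\<^bsub>\<Gamma>\<^esub> inv\<^bsub>\<Gamma>\<^esub> g | g s. g \<in> carrier \<Gamma> \<and> s \<in> S}"

text \<open>
  Vertices of the rooted binary tree are words over \<open>bool\<close>, with root \<open>[]\<close>; the first letter
  of a word selects the subtree below the root, \<open>False\<close> being the first subtree and \<open>True\<close>
  the second.
\<close>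

type_synonym vertex = "bool list"

definition child :: "vertex \<Rightarrow> vertex \<Rightarrow> bool" where
  "child v w \<longleftrightarrow> (\<exists>x. w = v @ [x])"

text \<open>Automorphisms act from the right: the product \<open>g h\<close> applies \<open>g\<close> first.\<close>

definition aut_T2 :: "(vertex \<Rightarrow> vertex) monoid" where
  "aut_T2 =
     \<lparr>carrier = {g. bij g \<and> g [] = [] \<and> (\<forall>v w. child (g v) (g w) \<longleftrightarrow> child v w)},
      monoid.mult = (\<lambda>g h. h \<circ> g),
      one = id\<rparr>"

text \<open>\<open>node g\<^sub>1 g\<^sub>2 s\<close> has states \<open>g\<^sub>1\<close>, \<open>g\<^sub>2\<close> and permutes the two subtrees below the root by \<open>s\<close>.\<close>

primrec node :: "(vertex \<Rightarrow> vertex) \<Rightarrow> (vertex \<Rightarrow> vertex) \<Rightarrow> (bool \<Rightarrow> bool) \<Rightarrow> vertex \<Rightarrow> vertex" where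
  "node g\<^sub>1 g\<^sub>2 s [] = []"
| "node g\<^sub>1 g\<^sub>2 s (x # w) = s x # (if x then g\<^sub>2 w else g\<^sub>1 w)"

definition grig_a :: "vertex \<Rightarrow> vertex" where
  "grig_a = node id id Not"

fun grig_b :: "vertex \<Rightarrow> vertex" and grig_c :: "vertex \<Rightarrow> vertex" and grig_d :: "vertex \<Rightarrow> vertex" where
  "grig_b [] = []"
| "grig_b (x # w) = x # (if x then grig_c w else grig_a w)"
| "grig_c [] = []"
| "grig_c (x # w) = x # (if x then grig_d w else grig_a w)"
| "grig_d [] = []"
| "grig_d (x # w) = x # (if x then grig_b w else w)"

definition grigorchuk_group :: "(vertex \<Rightarrow> vertex) monoid" where
  "grigorchuk_group = aut_T2\<lparr>carrier := generate aut_T2 {grig_a, grig_b, grig_c, grig_d}\<rparr>"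

definition grig_K :: "(vertex \<Rightarrow> vertex) set" where
  "grig_K =
     normal_closure grigorchuk_group
       {(grig_a \<otimes>\<^bsub>grigorchuk_group\<^esub> grig_b) [^]\<^bsub>grigorchuk_group\<^esub> (2::nat)}"


text \<open>The definitions agree with the wreath recursion.\<close>

lemma node_mult:
  "node g\<^sub>1 g\<^sub>2 s \<otimes>\<^bsub>aut_T2\<^esub> node h\<^sub>1 h\<^sub>2 t =
     node (g\<^sub>1 \<otimes>\<^bsub>aut_T2\<^esub> (if s False then h\<^sub>2 else h\<^sub>1))
          (g\<^sub>2 \<otimes>\<^bsub>aut_T2\<^esub> (if s True then h\<^sub>2 else h\<^sub>1)) (t \<circ> s)"
proof
  fix v show "(node g\<^sub>1 g\<^sub>2 s \<otimes>\<^bsub>aut_T2\<^esub> node h\<^sub>1 h\<^sub>2 t) v =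
     node (g\<^sub>1 \<otimes>\<^bsub>aut_T2\<^esub> (if s False then h\<^sub>2 else h\<^sub>1))
          (g\<^sub>2 \<otimes>\<^bsub>aut_T2\<^esub> (if s True then h\<^sub>2 else h\<^sub>1)) (t \<circ> s) v"
    by (cases v) (auto simp: aut_T2_def)
qed

lemma grig_b_node: "grig_b = node grig_a grig_c id"
  and grig_c_node: "grig_c = node grig_a grig_d id"
  and grig_d_node: "grig_d = node id grig_b id"
proof -
  have "grig_b v = node grig_a grig_c id v" "grig_c v = node grig_a grig_d id v"
    "grig_d v = node id grig_b id v" for v by (cases v; simp)+
  then show "grig_b = node grig_a grig_c id" "grig_c = node grig_a grig_d id"
    "grig_d = node id grig_b id" by blast+
qed

lemma group_aut_T2: "group aut_T2"
proof (rule groupI)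
  fix g assume g: "g \<in> carrier aut_T2"
  then have b: "bij g" and r: "g [] = []" and e: "\<And>v w. child (g v) (g w) \<longleftrightarrow> child v w"
    by (auto simp: aut_T2_def)
  have "inv_into UNIV g \<in> carrier aut_T2"
    using b r e[of "inv_into UNIV g _" "inv_into UNIV g _"]
    by (auto simp: aut_T2_def bij_imp_bij_inv bij_is_surj surj_f_inv_f bij_is_inj inv_f_eq)
  moreover have "inv_into UNIV g \<otimes>\<^bsub>aut_T2\<^esub> g = \<one>\<^bsub>aut_T2\<^esub>"
    using b by (auto simp: aut_T2_def fun_eq_iff bij_is_surj surj_f_inv_f)
  ultimately show "\<exists>h\<in>carrier aut_T2. h \<otimes>\<^bsub>aut_T2\<^esub> g = \<one>\<^bsub>aut_T2\<^esub>" by blast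
qed (auto simp: aut_T2_def bij_comp comp_assoc)

lemma aut_T2_append:
  assumes "g \<in> carrier aut_T2"
  shows "\<exists>y. g (v @ [x]) = g v @ [y]"
  using assms by (auto simp: aut_T2_def child_def)

lemma aut_T2I:
  assumes "h \<circ> g = id" "g \<circ> h = id" "g [] = []"
    and g: "\<And>v x. \<exists>y. g (v @ [x]) = g v @ [y]"
    and h: "\<And>v x. \<exists>y. h (v @ [x]) = h v @ [y]"
  shows "g \<in> carrier aut_T2"
proof -
  have "child (g v) (g w) \<longleftrightarrow> child v w" for v w
  proof
    assume "child v w" then show "child (g v) (g w)" using g by (auto simp: child_def)
  next
    assume "child (g v) (g w)"
    then obtain x where "g w = g v @ [x]" by (auto simp: child_def)
    then have "h (g w) = h (g v @ [x])" by simp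
    then show "child v w"
      using h[of "g v" x] assms(1) by (auto simp: child_def pointfree_idE)
  qed
  moreover have "bij g" using assms(1,2) by (rule o_bij)
  ultimately show ?thesis using assms(3) by (simp add: aut_T2_def)
qed

lemma node_append:
  assumes "g\<^sub>1 [] = []" "g\<^sub>2 [] = []"
    and "\<And>v x. \<exists>y. g\<^sub>1 (v @ [x]) = g\<^sub>1 v @ [y]" "\<And>v x. \<exists>y. g\<^sub>2 (v @ [x]) = g\<^sub>2 v @ [y]"
  shows "\<exists>y. node g\<^sub>1 g\<^sub>2 s (v @ [x]) = node g\<^sub>1 g\<^sub>2 s v @ [y]"
  using assms by (cases v) auto

lemma grig_generators_aut:
  "grig_a \<in> carrier aut_T2" "grig_b \<in> carrier aut_T2"
  "grig_c \<in> carrier aut_T2" "grig_d \<in> carrier aut_T2"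
proof -
  have nil: "grig_a [] = []" by (simp add: grig_a_def)
  have a: "grig_a (grig_a v) = v" for v by (cases v) (auto simp: grig_a_def)
  have inv: "grig_b (grig_b v) = v \<and> grig_c (grig_c v) = v \<and> grig_d (grig_d v) = v" for v
    by (induction v) (auto simp: a)
  have ea: "\<exists>y. grig_a (v @ [x]) = grig_a v @ [y]" for v x
    unfolding grig_a_def by (rule node_append) auto
  have ebcd: "(\<exists>y. grig_b (v @ [x]) = grig_b v @ [y]) \<and> (\<exists>y. grig_c (v @ [x]) = grig_c v @ [y])
    \<and> (\<exists>y. grig_d (v @ [x]) = grig_d v @ [y])" for v x
    by (induction v) (use ea in \<open>auto simp: nil\<close>)
  show "grig_a \<in> carrier aut_T2"
    by (rule aut_T2I[of grig_a]) (auto simp: fun_eq_iff a nil ea)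
  show "grig_b \<in> carrier aut_T2"
    by (rule aut_T2I[of grig_b]) (auto simp: fun_eq_iff inv ebcd)
  show "grig_c \<in> carrier aut_T2"
    by (rule aut_T2I[of grig_c]) (auto simp: fun_eq_iff inv ebcd)
  show "grig_d \<in> carrier aut_T2"
    by (rule aut_T2I[of grig_d]) (auto simp: fun_eq_iff inv ebcd)
qed

end

theory Submission
  imports Defs "HOL-Library.Product_Plus"
begin

text \<open>
  For the upper bound consider equations \<open>[x\<^sub>1, y\<^sub>1] \<cdots> [x\<^sub>n, y\<^sub>n] = g\<close> whose unknowns are confined to
  prescribed cosets of \<open>K\<close>. If \<open>g = \<llangle>g\<^sub>1, g\<^sub>2\<rrangle>\<close> and \<open>x\<^sub>1\<close> exchanges the two subtrees, one state can be
  eliminated, and what remains is such an equation of genus \<open>2n - 1\<close> for \<open>h g\<^sub>1 h\<^sup>-\<^sup>1 g\<^sub>2\<close>. Automorphisms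
  of the free group that fix the left-hand side bring the cosets into a normal form in which unknowns
  may be put equal to 1, so that the genus does not grow. Four systems of cosets of genus 3 reduce to
  each other in this way with \<open>h = 1\<close>, and \<open>g\<^sub>1g\<^sub>2\<close> is shorter than \<open>g\<close> for a suitable weight of words;
  hence they can be solved for every \<open>g \<in> K\<close> in the appropriate coset of \<open>[K, G]\<close>. The equations of genus 2
  for \<open>G'\<close>, and for the subgroup \<open>K \<times> K \<times> K \<times> K\<close> of \<open>K\<close> containing \<open>K'\<close>, reduce to these four.

  For the lower bound, the values of \<open>[x, y]\<close> in a quotient of \<open>G\<close> of order 256 are restricted by the cosets
  of \<open>x\<close> and \<open>y\<close> modulo \<open>K\<close>. Applied to the states of states, this excludes that particular elements are
  commutators.
\<close>

section \<open>The group of automorphisms of the binary tree as a type\<close>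

text \<open>Constraints are taken modulo K because K x K lies in G: whether a pair of states x, y
  gives an element of G, and which coset of K contains it, depends only on the cosets of x and y.
  Genus 3 is what the elimination produces from genus 2; from genus 3 it produces 5, so two handles
  must be made trivial to close the loop. Modulo [K, G] a commutator depends only on the cosets of
  its entries modulo K, so each system decides on which side of [K, G] in K its right-hand side
  lies: a handle with classes (a, b) contributes t = (ab)^2, outside [K, G], and one with (d, b)
  contributes [d, b] = 1. The reduced right-hand side may fall on either side, hence the even and
  odd systems and the two continuations of every reduction. Only the core uses induction, so only
  there must h be 1 to make the product of the states shorter; the remaining reductions form a
  finite chain and may use any h. In the lower bound the obstacle is an unknown that exchanges the
  subtrees: it conjugates one state of the witness by an unknown element. The witness is chosen so
  that every resulting product is excluded by one and the same check.\<close>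

lemma aut_T2_append_list:
  assumes "g \<in> carrier aut_T2"
  shows "\<exists>u. g (v @ w) = g v @ u \<and> length u = length w"
proof (induction w rule: rev_induct)
  case (snoc x w)
  then obtain u where u: "g (v @ w) = g v @ u" "length u = length w" by blast
  obtain y where "g ((v @ w) @ [x]) = g (v @ w) @ [y]"
    using aut_T2_append[OF assms, of "v @ w" x] by blast
  then show ?case using u by (intro exI[of _ "u @ [y]"]) auto
qed auto

lemma aut_T2_Cons:
  assumes "g \<in> carrier aut_T2"
  shows "g (x # w) = hd (g [x]) # tl (g (x # w))"
proof -
  have "g [] = []" using assms by (simp add: aut_T2_def)
  then obtain y where y: "g [x] = [y]" using aut_T2_append[OF assms, of "[]" x] by auto
  obtain u where "g ([x] @ w) = g [x] @ u" using aut_T2_append_list[OF assms] by blast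
  then show ?thesis using y by simp
qed

lemma aut_T2_node:
  assumes g: "g \<in> carrier aut_T2"
  obtains s g\<^sub>1 g\<^sub>2 where "g\<^sub>1 \<in> carrier aut_T2" "g\<^sub>2 \<in> carrier aut_T2" "g = node g\<^sub>1 g\<^sub>2 (\<lambda>x. x \<noteq> s)"
proof -
  interpret group aut_T2 by (rule group_aut_T2)
  define h where "h = inv\<^bsub>aut_T2\<^esub> g"
  have h: "h \<in> carrier aut_T2" using g by (simp add: h_def)
  have hg: "h (g v) = v" "g (h v) = v" for v
    using r_inv[OF g] l_inv[OF g] by (auto simp: aut_T2_def h_def fun_eq_iff)
  define \<sigma> where "\<sigma> k x = hd (k [x])" for k :: "vertex \<Rightarrow> vertex" and x
  define \<tau> where "\<tau> k x w = tl (k (x # w))" for k :: "vertex \<Rightarrow> vertex" and x w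
  have dec: "k (x # w) = \<sigma> k x # \<tau> k x w" if "k \<in> carrier aut_T2" for k x w
    using aut_T2_Cons[OF that] by (simp add: \<sigma>_def \<tau>_def)
  have hgd: "\<sigma> h (\<sigma> g x) = x \<and> \<tau> h (\<sigma> g x) (\<tau> g x w) = w" for x w
    using hg(1)[of "x # w"] by (simp add: dec[OF g] dec[OF h])
  have ghd: "\<sigma> g (\<sigma> h x) = x \<and> \<tau> g (\<sigma> h x) (\<tau> h x w) = w" for x w
    using hg(2)[of "x # w"] by (simp add: dec[OF g] dec[OF h])
  have app: "\<exists>y. \<tau> k x (v @ [z]) = \<tau> k x v @ [y]" if "k \<in> carrier aut_T2" for k x v z
  proof -
    have "\<exists>y. k ((x # v) @ [z]) = k (x # v) @ [y]" by (rule aut_T2_append[OF that])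
    then show ?thesis by (simp add: dec[OF that])
  qed
  have nil: "\<tau> g x [] = []" for x
  proof -
    have "g [] = []" using g by (simp add: aut_T2_def)
    then show ?thesis using aut_T2_append[OF g, of "[]" x] by (auto simp: \<tau>_def)
  qed
  have mem: "\<tau> g x \<in> carrier aut_T2" for x
  proof (rule aut_T2I[of "\<tau> h (\<sigma> g x)"])
    show "\<tau> h (\<sigma> g x) \<circ> \<tau> g x = id" using hgd by (simp add: fun_eq_iff)
    show "\<tau> g x \<circ> \<tau> h (\<sigma> g x) = id" using ghd[of "\<sigma> g x"] hgd by (simp add: fun_eq_iff)
  qed (rule nil app[OF g] app[OF h])+
  have "\<sigma> g True \<noteq> \<sigma> g False" using hgd by metis
  then have s: "\<sigma> g x = (x \<noteq> \<sigma> g False)" for x by (cases x) auto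
  have "g v = node (\<tau> g False) (\<tau> g True) (\<lambda>x. x \<noteq> \<sigma> g False) v" for v
  proof (cases v)
    case Nil then show ?thesis using g by (simp add: aut_T2_def)
  next
    case (Cons x w) then show ?thesis using s[of x] by (cases x) (auto simp: dec[OF g])
  qed
  then show thesis using that mem by blast
qed

lemma node_in_aut_T2:
  assumes "g\<^sub>1 \<in> carrier aut_T2" "g\<^sub>2 \<in> carrier aut_T2"
  shows "node g\<^sub>1 g\<^sub>2 (\<lambda>x. x \<noteq> s) \<in> carrier aut_T2"
proof -
  interpret group aut_T2 by (rule group_aut_T2)
  define h\<^sub>1 where "h\<^sub>1 = inv\<^bsub>aut_T2\<^esub> g\<^sub>1"
  define h\<^sub>2 where "h\<^sub>2 = inv\<^bsub>aut_T2\<^esub> g\<^sub>2"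
  have h: "h\<^sub>1 \<in> carrier aut_T2" "h\<^sub>2 \<in> carrier aut_T2" using assms by (auto simp: h\<^sub>1_def h\<^sub>2_def)
  have i: "h\<^sub>1 (g\<^sub>1 v) = v" "g\<^sub>1 (h\<^sub>1 v) = v" "h\<^sub>2 (g\<^sub>2 v) = v" "g\<^sub>2 (h\<^sub>2 v) = v" for v
    using r_inv[OF assms(1)] l_inv[OF assms(1)] r_inv[OF assms(2)] l_inv[OF assms(2)]
    by (auto simp: aut_T2_def h\<^sub>1_def h\<^sub>2_def fun_eq_iff)
  have nil: "g [] = []" if "g \<in> carrier aut_T2" for g using that by (simp add: aut_T2_def)
  define h where "h = node (if s then h\<^sub>2 else h\<^sub>1) (if s then h\<^sub>1 else h\<^sub>2) (\<lambda>x. x \<noteq> s)"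
  have "h (node g\<^sub>1 g\<^sub>2 (\<lambda>x. x \<noteq> s) v) = v" "node g\<^sub>1 g\<^sub>2 (\<lambda>x. x \<noteq> s) (h v) = v" for v
    by (cases v; auto simp: h_def i)+
  moreover have "\<exists>y. h (v @ [x]) = h v @ [y]" for v x
    unfolding h_def using h by (intro node_append) (simp_all add: aut_T2_append nil)
  moreover have "\<exists>y. node g\<^sub>1 g\<^sub>2 (\<lambda>x. x \<noteq> s) (v @ [x]) = node g\<^sub>1 g\<^sub>2 (\<lambda>x. x \<noteq> s) v @ [y]" for v x
    using assms by (intro node_append) (simp_all add: aut_T2_append nil)
  ultimately show ?thesis by (intro aut_T2I[of h] ext) simp_all
qed

typedef aut = "carrier aut_T2" morphisms fun_of Aut
  using monoid.one_closed[OF group.is_monoid[OF group_aut_T2]] by blast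

text \<open>The product is written additively, so that the (noncommutative) class \<open>group_add\<close> applies.\<close>

instantiation aut :: group_add
begin

definition zero_aut :: aut where "0 = Aut \<one>\<^bsub>aut_T2\<^esub>"
definition plus_aut :: "aut \<Rightarrow> aut \<Rightarrow> aut" where "x + y = Aut (fun_of x \<otimes>\<^bsub>aut_T2\<^esub> fun_of y)"
definition uminus_aut :: "aut \<Rightarrow> aut" where "- x = Aut (inv\<^bsub>aut_T2\<^esub> (fun_of x))"
definition minus_aut :: "aut \<Rightarrow> aut \<Rightarrow> aut" where "x - y = x + - (y :: aut)"

lemma fun_of_0: "fun_of 0 = \<one>\<^bsub>aut_T2\<^esub>"
  and fun_of_plus: "fun_of (x + y) = fun_of x \<otimes>\<^bsub>aut_T2\<^esub> fun_of y"
  and fun_of_uminus: "fun_of (- x) = inv\<^bsub>aut_T2\<^esub> (fun_of x)"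
proof -
  interpret group aut_T2 by (rule group_aut_T2)
  show "fun_of 0 = \<one>\<^bsub>aut_T2\<^esub>" "fun_of (x + y) = fun_of x \<otimes>\<^bsub>aut_T2\<^esub> fun_of y"
    "fun_of (- x) = inv\<^bsub>aut_T2\<^esub> (fun_of x)"
    by (auto simp: zero_aut_def plus_aut_def uminus_aut_def Aut_inverse fun_of)
qed

instance
proof
  interpret group aut_T2 by (rule group_aut_T2)
  fix x y z :: aut
  show "x + y + z = x + (y + z)" "0 + x = x" "x + 0 = x" "- x + x = 0" "x + - y = x - y"
    by (auto simp: fun_of_inject[symmetric] fun_of_plus fun_of_0 fun_of_uminus fun_of m_assoc minus_aut_def)
qed

end

definition N :: "bool \<Rightarrow> aut \<Rightarrow> aut \<Rightarrow> aut" where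
  "N s x y = Aut (node (fun_of x) (fun_of y) (\<lambda>z. z \<noteq> s))"

lemma fun_of_N: "fun_of (N s x y) = node (fun_of x) (fun_of y) (\<lambda>z. z \<noteq> s)"
  unfolding N_def by (intro Aut_inverse node_in_aut_T2 fun_of)

lemma node_inject:
  assumes "node g\<^sub>1 g\<^sub>2 s = node h\<^sub>1 h\<^sub>2 t" shows "g\<^sub>1 = h\<^sub>1" "g\<^sub>2 = h\<^sub>2" "s = t"
proof -
  have *: "node g\<^sub>1 g\<^sub>2 s (x # w) = node h\<^sub>1 h\<^sub>2 t (x # w)" for x w using assms by simp
  show "g\<^sub>1 = h\<^sub>1" "g\<^sub>2 = h\<^sub>2" "s = t" using *[of False] *[of True] * by (auto simp: fun_eq_iff)
qed

lemma N_inject [simp]: "N s x y = N t u v \<longleftrightarrow> s = t \<and> x = u \<and> y = v"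
proof
  assume "N s x y = N t u v"
  then have *: "node (fun_of x) (fun_of y) (\<lambda>z. z \<noteq> s) = node (fun_of u) (fun_of v) (\<lambda>z. z \<noteq> t)"
    by (metis fun_of_N)
  from node_inject(3)[OF *] have "s = t" by (metis (full_types))
  with node_inject(1,2)[OF *] show "s = t \<and> x = u \<and> y = v" by (simp add: fun_of_inject)
qed auto

lemma N_exhaust: obtains s y z where "x = N s y z"
proof -
  obtain s g\<^sub>1 g\<^sub>2 where *: "g\<^sub>1 \<in> carrier aut_T2" "g\<^sub>2 \<in> carrier aut_T2" "fun_of x = node g\<^sub>1 g\<^sub>2 (\<lambda>x. x \<noteq> s)"
    using aut_T2_node[OF fun_of] by metis
  then have "fun_of x = fun_of (N s (Aut g\<^sub>1) (Aut g\<^sub>2))" by (simp add: fun_of_N Aut_inverse)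
  then show thesis using that by (auto simp: fun_of_inject)
qed

lemma N_plus: "N s x y + N t u v = N (s \<noteq> t) (x + (if s then v else u)) (y + (if s then u else v))"
proof -
  have "fun_of (N s x y + N t u v) =
      fun_of (N (s \<noteq> t) (x + (if s then v else u)) (y + (if s then u else v)))"
    unfolding fun_of_plus fun_of_N node_mult by (cases s; cases t) (simp_all add: comp_def fun_of_plus cong: if_cong)
  then show ?thesis by (simp only: fun_of_inject)
qed

lemma N_zero: "N False 0 0 = 0"
proof -
  have "N False 0 0 + N False 0 0 = N False 0 0 + 0" by (simp add: N_plus)
  then show ?thesis by (rule add_left_imp_eq)
qed

lemma N_uminus: "- N s x y = N s (if s then - y else - x) (if s then - x else - y)"
  by (rule minus_unique) (simp add: N_plus N_zero)

definition act :: "aut \<Rightarrow> bool" where "act x = (THE s. \<exists>y z. x = N s y z)"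
definition sec0 :: "aut \<Rightarrow> aut" where "sec0 x = (THE y. \<exists>s z. x = N s y z)"
definition sec1 :: "aut \<Rightarrow> aut" where "sec1 x = (THE z. \<exists>s y. x = N s y z)"

lemma act_N [simp]: "act (N s y z) = s" and sec0_N [simp]: "sec0 (N s y z) = y" and sec1_N [simp]: "sec1 (N s y z) = z"
  by (auto simp: act_def sec0_def sec1_def)

lemma N_sec: "N (act x) (sec0 x) (sec1 x) = x"
  by (rule N_exhaust[of x]) auto

lemma act_0 [simp]: "act 0 = False" and sec0_0 [simp]: "sec0 0 = 0" and sec1_0 [simp]: "sec1 0 = 0"
  using act_N[of False 0 0] sec0_N[of False 0 0] sec1_N[of False 0 0] by (simp_all add: N_zero)

lemma act_plus: "act (x + y) = (act x \<noteq> act y)"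
  and sec0_plus: "sec0 (x + y) = sec0 x + (if act x then sec1 y else sec0 y)"
  and sec1_plus: "sec1 (x + y) = sec1 x + (if act x then sec0 y else sec1 y)"
  by (rule N_exhaust[of x], rule N_exhaust[of y], simp add: N_plus)+

lemma act_uminus: "act (- x) = act x"
  and sec0_uminus: "sec0 (- x) = (if act x then - sec1 x else - sec0 x)"
  and sec1_uminus: "sec1 (- x) = (if act x then - sec0 x else - sec1 x)"
  by (rule N_exhaust[of x], simp add: N_uminus)+



text \<open>As a simp set this reduces group words to a normal form, so \<open>simp only\<close>
  decides identities of the free group such as commutator expansions.\<close>

lemmas free_group = add.assoc diff_conv_add_uminus minus_add minus_minus add_0_left add_0_right
  minus_add_cancel add_minus_cancel left_minus right_minus minus_zero

section \<open>The Grigorchuk group and its subgroup K\<close>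

definition gA :: aut where "gA = Aut grig_a"
definition gB :: aut where "gB = Aut grig_b"
definition gC :: aut where "gC = Aut grig_c"
definition gD :: aut where "gD = Aut grig_d"

lemma fun_of_gens [simp]: "fun_of gA = grig_a" "fun_of gB = grig_b" "fun_of gC = grig_c" "fun_of gD = grig_d"
  by (simp_all add: gA_def gB_def gC_def gD_def Aut_inverse grig_generators_aut)

lemma fun_of_0_id: "fun_of 0 = id"
  by (simp add: fun_of_0 aut_T2_def)

lemma gens_N: "gA = N True 0 0" "gB = N False gA gC" "gC = N False gA gD" "gD = N False 0 gB"
proof -
  have "(\<lambda>z. z \<noteq> True) = Not" "(\<lambda>z. z \<noteq> False) = (id :: bool \<Rightarrow> bool)" by auto
  then show "gA = N True 0 0" "gB = N False gA gC" "gC = N False gA gD" "gD = N False 0 gB"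
    by (simp_all add: fun_of_inject[symmetric] fun_of_N fun_of_0_id grig_a_def[symmetric]
        grig_b_node[symmetric] grig_c_node[symmetric] grig_d_node[symmetric])
qed

lemma gA_gA: "gA + gA = 0"
  by (simp add: gens_N(1) N_plus N_zero)

lemma bcd_involutions: "gB + gB = 0 \<and> gC + gC = 0 \<and> gD + gD = 0"
proof -
  have aa: "grig_a (grig_a v) = v" for v by (cases v) (auto simp: grig_a_def)
  have "grig_b (grig_b v) = v \<and> grig_c (grig_c v) = v \<and> grig_d (grig_d v) = v" for v
    by (induction v) (auto simp: aa)
  then show ?thesis
    by (simp add: fun_of_inject[symmetric] fun_of_plus fun_of_0 aut_T2_def fun_eq_iff)
qed

lemma klein_relations: "gB + gC = gD \<and> gC + gD = gB \<and> gD + gB = gC"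
proof -
  have aa: "grig_a (grig_a v) = v" for v by (cases v) (auto simp: grig_a_def)
  have "grig_c (grig_b v) = grig_d v \<and> grig_d (grig_c v) = grig_b v \<and> grig_b (grig_d v) = grig_c v" for v
    by (induction v) (auto simp: aa)
  then show ?thesis
    by (simp add: fun_of_inject[symmetric] fun_of_plus aut_T2_def fun_eq_iff)
qed

lemma uminus_gens: "- gA = gA" "- gB = gB" "- gC = gC" "- gD = gD"
  using gA_gA bcd_involutions by (auto intro: minus_unique)

lemma gens_mult:
  "gA + gA = 0" "gB + gB = 0" "gC + gC = 0" "gD + gD = 0"
  "gB + gC = gD" "gC + gD = gB" "gD + gB = gC" "gC + gB = gD" "gD + gC = gB" "gB + gD = gC"
proof -
  show *: "gA + gA = 0" "gB + gB = 0" "gC + gC = 0" "gD + gD = 0"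
    "gB + gC = gD" "gC + gD = gB" "gD + gB = gC"
    using gA_gA bcd_involutions klein_relations by auto
  show "gC + gB = gD" "gD + gC = gB" "gB + gD = gC"
    using * minus_add[of gB gC] minus_add[of gC gD] minus_add[of gD gB] by (simp_all add: uminus_gens)
qed

lemma gens_mult_left:
  "gA + (gA + x) = x" "gB + (gB + x) = x" "gC + (gC + x) = x" "gD + (gD + x) = x"
  "gB + (gC + x) = gD + x" "gC + (gD + x) = gB + x" "gD + (gB + x) = gC + x"
  "gC + (gB + x) = gD + x" "gD + (gC + x) = gB + x" "gB + (gD + x) = gC + x"
  by (simp_all add: add.assoc[symmetric] gens_mult)

lemma diff_gens: "x - gA = x + gA" "x - gB = x + gB" "x - gC = x + gC" "x - gD = x + gD"
  unfolding diff_conv_add_uminus uminus_gens by (rule refl)+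

lemmas gens_simps = gens_mult gens_mult_left uminus_gens diff_gens

inductive_set G :: "aut set" where
  zero_in_G: "0 \<in> G"
| G_step: "\<lbrakk>x \<in> G; g \<in> {gA, gB, gC, gD}\<rbrakk> \<Longrightarrow> x + g \<in> G"

lemma gens_in_G [simp]: "gA \<in> G" "gB \<in> G" "gC \<in> G" "gD \<in> G"
  using G_step[OF zero_in_G] by force+

declare zero_in_G [simp]

lemma G_plus [simp]:
  assumes "x \<in> G" "y \<in> G" shows "x + y \<in> G"
  using assms(2,1) by induction (auto simp: add.assoc[symmetric] intro: G_step)

lemma G_uminus [simp]: "x \<in> G \<Longrightarrow> - x \<in> G"
  by (induction rule: G.induct) (auto simp: minus_add uminus_gens simp del: add_uminus_conv_diff)

lemma G_diff [simp]: "\<lbrakk>x \<in> G; y \<in> G\<rbrakk> \<Longrightarrow> x - y \<in> G"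
  by (simp only: diff_conv_add_uminus G_plus G_uminus)

definition comm :: "'a::group_add \<Rightarrow> 'a \<Rightarrow> 'a" where "comm x y = x + y - x - y"

lemma comm_in_G [simp]: "\<lbrakk>x \<in> G; y \<in> G\<rbrakk> \<Longrightarrow> comm x y \<in> G"
  by (simp add: comm_def)

definition t_elt :: aut where "t_elt = gA + gB + gA + gB"

lemma t_elt_in_G [simp]: "t_elt \<in> G"
  by (simp add: t_elt_def)

text \<open>Closure under inverses comes from t^-1 = b t b^-1 (\<open>uminus_t_elt\<close>), so
  products of conjugates of t already form a group.\<close>

inductive_set K :: "aut set" where
  zero_in_K: "0 \<in> K"
| K_step: "\<lbrakk>k \<in> K; g \<in> G\<rbrakk> \<Longrightarrow> k + (g + t_elt - g) \<in> K"

lemma K_plus: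
  assumes "x \<in> K" "y \<in> K" shows "x + y \<in> K"
  using assms(2,1)
proof induction
  case (K_step k g)
  then show ?case using K.K_step[of "x + k" g] by (simp add: add.assoc)
qed simp

lemma t_elt_in_K: "g \<in> G \<Longrightarrow> g + t_elt - g \<in> K"
  using K_step[OF zero_in_K] by simp

lemma K_conj:
  assumes "k \<in> K" "g \<in> G" shows "g + k - g \<in> K"
  using assms(1)
proof induction
  case (K_step k h)
  have "g + (k + (h + t_elt - h)) - g = (g + k - g) + ((g + h) + t_elt - (g + h))"
    by (simp only: free_group)
  then show ?case using K_step assms(2) t_elt_in_K[of "g + h"] K_plus by auto
qed (simp add: zero_in_K)

lemma uminus_t_elt: "- t_elt = gB + t_elt - gB"
  by (simp add: t_elt_def minus_add gens_simps diff_conv_add_uminus add.assoc del: add_uminus_conv_diff)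

lemma K_uminus: "x \<in> K \<Longrightarrow> - x \<in> K"
proof (induction rule: K.induct)
  case (K_step k g)
  have "- (k + (g + t_elt - g)) = (g + - t_elt - g) + - k"
    by (simp only: free_group)
  also have "g + - t_elt - g = (g + gB) + t_elt - (g + gB)"
    unfolding uminus_t_elt by (simp only: free_group)
  finally show ?case using K_plus[OF t_elt_in_K[of "g + gB"] K_step.IH] K_step.hyps by simp
qed (simp add: zero_in_K)

lemma K_sub_G: "x \<in> K \<Longrightarrow> x \<in> G"
  by (induction rule: K.induct) auto

section \<open>The quotient by K\<close>

text \<open>
  \<open>K\<close> has index 16 in \<open>G\<close>, and \<open>G/K\<close> is the product of the group \<open>\<langle>b\<rangle>\<close> of order 2 and the dihedral
  group \<open>\<langle>a, d\<rangle>\<close> of order 8. The latter is the wreath product of two groups of order 2: in \<open>Q s k\<^sub>1 k\<^sub>2 e\<close>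
  the first three arguments are \<open>\<llangle>k\<^sub>1, k\<^sub>2\<rrangle>s\<close>, and \<open>e\<close> is the exponent of \<open>b\<close>.
\<close>

datatype Q = Q bool bool bool bool

instantiation Q :: group_add
begin

definition zero_Q :: Q where "0 = Q False False False False"

fun plus_Q :: "Q \<Rightarrow> Q \<Rightarrow> Q" where
  "Q s k\<^sub>1 k\<^sub>2 e + Q t m\<^sub>1 m\<^sub>2 f =
     Q (s \<noteq> t) (k\<^sub>1 \<noteq> (if s then m\<^sub>2 else m\<^sub>1)) (k\<^sub>2 \<noteq> (if s then m\<^sub>1 else m\<^sub>2)) (e \<noteq> f)"

fun uminus_Q :: "Q \<Rightarrow> Q" where
  "- Q s k\<^sub>1 k\<^sub>2 e = Q s (if s then k\<^sub>2 else k\<^sub>1) (if s then k\<^sub>1 else k\<^sub>2) e"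

definition minus_Q :: "Q \<Rightarrow> Q \<Rightarrow> Q" where "x - y = x + - (y :: Q)"

instance
proof
  fix x y z :: Q
  obtain s k\<^sub>1 k\<^sub>2 e t m\<^sub>1 m\<^sub>2 f where xy: "x = Q s k\<^sub>1 k\<^sub>2 e" "y = Q t m\<^sub>1 m\<^sub>2 f" by (cases x; cases y)
  show "x + y + z = x + (y + z)"
    unfolding xy by (cases z; cases s; cases t; simp; argo)
  show "0 + x = x" "x + 0 = x" "- x + x = 0" by (cases x; auto simp: zero_Q_def)+
  show "x + - y = x - y" by (simp add: minus_Q_def)
qed

end

text \<open>The parities of the numbers of vertices of level 1 and 2 at which an automorphism acts nontrivially.\<close>

definition parity1 :: "aut \<Rightarrow> bool" where "parity1 x \<longleftrightarrow> act (sec0 x) \<noteq> act (sec1 x)"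
definition parity2 :: "aut \<Rightarrow> bool" where "parity2 x \<longleftrightarrow> parity1 (sec0 x) \<noteq> parity1 (sec1 x)"
definition class_K :: "aut \<Rightarrow> Q" where "class_K x = Q (act x) (parity2 (sec0 x)) (parity2 (sec1 x)) (parity1 x)"

lemma parity1_plus: "parity1 (x + y) = (parity1 x \<noteq> parity1 y)"
  by (auto simp: parity1_def sec0_plus sec1_plus act_plus)

lemma parity2_plus: "parity2 (x + y) = (parity2 x \<noteq> parity2 y)"
  by (auto simp: parity2_def sec0_plus sec1_plus parity1_plus)

lemma class_K_plus: "class_K (x + y) = class_K x + class_K y"
  by (auto simp: class_K_def sec0_plus sec1_plus parity1_plus parity2_plus act_plus)

lemma class_K_0 [simp]: "class_K 0 = 0"
  by (simp add: class_K_def parity1_def parity2_def zero_Q_def)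

lemma class_K_uminus: "class_K (- x) = - class_K x"
  by (rule minus_unique[symmetric]) (simp add: class_K_plus[symmetric])

lemma class_K_diff: "class_K (x - y) = class_K x - class_K y"
  by (simp only: diff_conv_add_uminus class_K_plus class_K_uminus)

lemma class_K_comm: "class_K (comm x y) = comm (class_K x) (class_K y)"
  by (simp add: comm_def class_K_plus class_K_diff)

lemma gens_act: "act gA" "\<not> act gB" "\<not> act gC" "\<not> act gD"
  by (subst gens_N; simp)+

lemma gens_sec:
  "sec0 gA = 0" "sec0 gB = gA" "sec0 gC = gA" "sec0 gD = 0"
  "sec1 gA = 0" "sec1 gB = gC" "sec1 gC = gD" "sec1 gD = gB"
  by (subst gens_N; simp)+

lemma parity12_0: "\<not> parity1 0" "\<not> parity2 0"
  by (auto simp: parity1_def parity2_def)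

lemma gens_s: "\<not> parity1 gA" "parity1 gB" "parity1 gC" "\<not> parity1 gD" "\<not> parity2 gA" "parity2 gB" "\<not> parity2 gC" "parity2 gD"
  by (auto simp: parity1_def parity2_def gens_sec gens_act)

lemma class_K_gens: "class_K gA = Q True False False False" "class_K gB = Q False False False True"
  "class_K gC = Q False False True True" "class_K gD = Q False False True False"
  by (auto simp: class_K_def gens_sec gens_act gens_s parity12_0)

lemma comm_Q:
  "comm (Q s k\<^sub>1 k\<^sub>2 e) (Q t m\<^sub>1 m\<^sub>2 f) =
     (let k = ((s \<and> m\<^sub>1 \<noteq> m\<^sub>2) \<noteq> (t \<and> k\<^sub>1 \<noteq> k\<^sub>2)) in Q False k k False)"
  unfolding comm_def minus_Q_def by (cases s; cases t; simp add: Let_def; argo)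

lemma Q_commutator_central: "comm p q + r = r + (comm p q :: Q)"
proof -
  obtain k where "comm p q = Q False k k False" by (cases p; cases q) (auto simp: comm_Q Let_def)
  then show ?thesis by (cases r) auto
qed

fun rep :: "Q \<Rightarrow> aut" where
  "rep (Q s k\<^sub>1 k\<^sub>2 e) = (if e then gB else 0) + (if k\<^sub>1 then gA + gD + gA else 0) + (if k\<^sub>2 then gD else 0)
     + (if s then gA else 0)"

lemma rep_in_G [simp]: "rep q \<in> G"
  by (cases q) auto

lemma class_K_rep [simp]: "class_K (rep q) = q"
  by (cases q) (auto simp: class_K_plus class_K_gens zero_Q_def)

lemma class_K_tt: "class_K t_elt = 0"
  by (simp add: t_elt_def class_K_plus class_K_gens zero_Q_def)

lemma class_K_K: "k \<in> K \<Longrightarrow> class_K k = 0"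
  by (induction rule: K.induct) (simp_all add: class_K_plus class_K_diff class_K_tt)

lemma comm_gB_in_K: "x \<in> G \<Longrightarrow> comm x gB \<in> K"
proof (induction rule: G.induct)
  case (G_step x g)
  have "comm g gB \<in> K"
  proof -
    consider "g = gA" | "comm g gB = 0"
      using G_step.hyps(2) by (auto simp: comm_def gens_simps)
    then show ?thesis
    proof cases
      case 1
      then have "comm g gB = t_elt" by (simp add: comm_def t_elt_def uminus_gens diff_conv_add_uminus del: add_uminus_conv_diff)
      then show ?thesis using t_elt_in_K[of 0] by simp
    qed (simp add: zero_in_K)
  qed
  moreover have "comm (x + g) gB = (x + comm g gB - x) + comm x gB"
    unfolding comm_def by (simp only: free_group)
  ultimately show ?case using G_step K_plus K_conj by simp
qed (simp add: comm_def zero_in_K)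

lemma gA_gD_order: "gA + gD + gA + gD = gD + gA + gD + gA"
  by (simp add: gens_N(1,4) N_plus)

text \<open>Modulo K the generator b is central (\<open>comm_gB_in_K\<close>), so it can be moved to
  the front of a representative. Multiplication by a or d maps representatives to representatives
  exactly, because adad = dada.\<close>

lemma G_rep: "x \<in> G \<Longrightarrow> x - rep (class_K x) \<in> K"
proof (induction rule: G.induct)
  case (G_step x g)
  define k where "k = x - rep (class_K x)"
  have k: "k \<in> K" "x = k + rep (class_K x)" using G_step by (auto simp: k_def)
  obtain s k\<^sub>1 k\<^sub>2 e where q: "class_K x = Q s k\<^sub>1 k\<^sub>2 e" by (cases "class_K x")
  have comm: "gA + (gD + (gA + gD)) = gD + (gA + (gD + gA))"
    "gA + (gD + (gA + (gD + y))) = gD + (gA + (gD + (gA + y)))" for y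
    using gA_gD_order by (simp_all add: add.assoc[symmetric])
  have bstep: "y + gB - rep (class_K (y + gB)) \<in> K" if y: "y \<in> G" "y - rep (class_K y) \<in> K" for y
  proof -
    define r where "r = rep (class_K y)"
    have "rep (class_K (y + gB)) = gB + r"
      unfolding r_def by (cases "class_K y") (auto simp: class_K_plus class_K_gens add.assoc gens_simps)
    then have "y + gB - rep (class_K (y + gB)) = (y - r) + comm r gB"
      unfolding comm_def by (simp only: free_group)
    then show ?thesis using y K_plus comm_gB_in_K[of r] by (simp add: r_def)
  qed
  have dstep: "y + g - rep (class_K (y + g)) \<in> K" if "y - rep (class_K y) \<in> K" "g = gA \<or> g = gD" for y g
  proof -
    have "rep (class_K y + class_K g) = rep (class_K y) + g"
      using that(2) by (cases "class_K y") (auto simp: class_K_gens add.assoc gens_simps comm)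
    then have "y + g - rep (class_K (y + g)) = y - rep (class_K y)" by (simp only: class_K_plus free_group)
    then show ?thesis using that by simp
  qed
  show ?case
  proof (cases "g = gC")
    case True
    then have "x + g = x + gB + gD" by (simp add: add.assoc gens_simps)
    then show ?thesis using G_step bstep[of x] dstep[of "x + gB" gD] by simp
  next
    case False
    then show ?thesis using G_step bstep[of x] dstep[of x] by auto
  qed
qed (simp add: zero_Q_def zero_in_K)

lemma K_iff: "x \<in> K \<longleftrightarrow> x \<in> G \<and> class_K x = 0"
  using G_rep[of x] class_K_K[of x] K_sub_G[of x] by (auto simp: zero_Q_def)

section \<open>States\<close>

text \<open>
  For \<open>x, y \<in> G\<close> the element \<open>\<llangle>x, y\<rrangle>\<close> is in \<open>G\<close> iff the images of \<open>x\<close> and \<open>y\<close> in \<open>\<langle>a, d\<rangle>\<close> are exchanged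
  by the automorphism of \<open>\<langle>a, d\<rangle>\<close> that swaps \<open>a\<close> and \<open>d\<close>.
\<close>

fun liftable :: "Q \<Rightarrow> Q \<Rightarrow> bool" where
  "liftable (Q s k\<^sub>1 k\<^sub>2 e) (Q t m\<^sub>1 m\<^sub>2 f) \<longleftrightarrow>
     t = (k\<^sub>1 \<noteq> k\<^sub>2) \<and> m\<^sub>1 = (if s then k\<^sub>2 else k\<^sub>1) \<and> m\<^sub>2 = (if s then \<not> k\<^sub>2 else k\<^sub>1)"

fun lift_class :: "bool \<Rightarrow> Q \<Rightarrow> Q \<Rightarrow> Q" where
  "lift_class s (Q t k\<^sub>1 k\<^sub>2 e) (Q u m\<^sub>1 m\<^sub>2 f) = Q s ((k\<^sub>1 \<noteq> k\<^sub>2) \<noteq> e) ((m\<^sub>1 \<noteq> m\<^sub>2) \<noteq> f) (t \<noteq> u)"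

lemma liftable_plus:
  assumes "liftable p q" "liftable p' q'" shows "liftable (p + p') (q + q')"
  using assms by (cases p; cases p'; cases q; cases q') (auto split: if_splits)

lemma liftable_sym: "liftable p q \<Longrightarrow> liftable q p"
  by (cases p; cases q) (auto split: if_splits)

lemma liftable_0: "liftable 0 0"
  by (simp add: zero_Q_def)

lemma liftable_unique:
  assumes "liftable p q" "liftable p q'" shows "q - q' \<in> {0, class_K gB}"
  using assms by (cases p; cases q; cases q') (auto simp: minus_Q_def zero_Q_def class_K_gens split: if_splits)

lemma liftable_gens:
  "liftable (class_K gA) (class_K gC)" "liftable (class_K gC) (class_K gA)" "liftable (class_K gA) (class_K gD)" "liftable (class_K gD) (class_K gA)" "liftable 0 (class_K gB)" "liftable (class_K gB) 0"
  by (simp_all add: class_K_gens zero_Q_def)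

text \<open>\<open>parity2\<close> is not a component of \<open>class_K\<close>, but on G it is a
  function of it. This makes the class of an element computable from the classes of its
  states.\<close>

lemma parity2_eq: "x \<in> G \<Longrightarrow> parity2 x \<longleftrightarrow> (parity2 (sec0 x) \<noteq> parity2 (sec1 x)) \<noteq> parity1 x"
  by (induction rule: G.induct)
    (auto simp: parity12_0 parity1_plus parity2_plus sec0_plus sec1_plus gens_sec gens_s)

lemma class_K_N:
  assumes "x \<in> G" "y \<in> G" shows "class_K (N s x y) = lift_class s (class_K x) (class_K y)"
  using parity2_eq[OF assms(1)] parity2_eq[OF assms(2)] by (simp add: class_K_def parity1_def[of "N s x y"])

lemma G_states: "x \<in> G \<Longrightarrow> sec0 x \<in> G \<and> sec1 x \<in> G \<and> liftable (class_K (sec0 x)) (class_K (sec1 x))"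
proof (induction rule: G.induct)
  case (G_step x g)
  have g: "sec0 g \<in> G" "sec1 g \<in> G" "liftable (class_K (sec0 g)) (class_K (sec1 g))"
    using G_step.hyps(2) liftable_gens liftable_0 by (auto simp: gens_sec)
  then show ?case
    using G_step liftable_plus liftable_sym by (auto simp: sec0_plus sec1_plus class_K_plus)
qed (auto simp: liftable_0)

lemma G_cases:
  assumes "x \<in> G"
  obtains s y z where "x = N s y z" "y \<in> G" "z \<in> G" "liftable (class_K y) (class_K z)" "class_K x = lift_class s (class_K y) (class_K z)"
  using that[of "act x" "sec0 x" "sec1 x"] G_states[OF assms] class_K_N[of "sec0 x" "sec1 x" "act x"]
  by (simp add: N_sec)

lemma conj_gens_N:
  "gA + gB + gA = N False gC gA" "gA + gC + gA = N False gD gA" "gA + gD + gA = N False gB 0"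
  by (subst (1 2) gens_N(1), subst gens_N(2-4), simp add: N_plus)+

lemma G_partner:
  assumes "x \<in> G" obtains y where "y \<in> G" "N False x y \<in> G"
proof -
  have "\<exists>y\<in>G. N False x y \<in> G"
    using assms
  proof induction
    case zero_in_G
    show ?case by (rule bexI[of _ 0]) (simp_all add: N_zero)
  next
    case (G_step x g)
    have "\<exists>y\<in>G. N False g y \<in> G"
      using G_step.hyps(2) gens_N conj_gens_N G_plus gens_in_G zero_in_G by (auto; metis)
    then obtain y y' where "y \<in> G" "N False x y \<in> G" "y' \<in> G" "N False g y' \<in> G"
      using G_step.IH by blast
    moreover have "N False x y + N False g y' = N False (x + g) (y + y')" by (simp add: N_plus)
    ultimately show ?case by (metis G_plus)
  qed
  then show thesis using that by blast
qed

lemma N_conj_gA: "gA + N s x y - gA = N s y x"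
  by (simp add: gens_N(1) N_plus N_uminus diff_conv_add_uminus del: add_uminus_conv_diff)

text \<open>The source of branching: conjugation by elements with prescribed first state
  (\<open>G_partner\<close>) turns t in the first place into an arbitrary conjugate of t.\<close>

lemma uu_N: "comm gB (gA + gD + gA) = N False t_elt 0"
proof -
  have "comm gB (gA + gD + gA) = N False gA gC + N False gB 0 - N False gA gC - N False gB 0"
    unfolding comm_def conj_gens_N(3) by (simp only: gens_N(2)[symmetric])
  then show ?thesis
    by (simp add: N_plus N_uminus t_elt_def add.assoc gens_simps diff_conv_add_uminus del: add_uminus_conv_diff)
qed

lemma N_K_0_in_G: "k \<in> K \<Longrightarrow> N False k 0 \<in> G"
proof (induction rule: K.induct)
  case (K_step k g)
  obtain y where y: "y \<in> G" "N False g y \<in> G" using G_partner[OF K_step.hyps(2)] .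
  have "N False (k + (g + t_elt - g)) 0 = N False k 0 + (N False g y + comm gB (gA + gD + gA) - N False g y)"
    unfolding uu_N by (simp add: N_plus N_uminus diff_conv_add_uminus del: add_uminus_conv_diff)
  then show ?case using K_step y by simp
qed (simp add: N_zero)

text \<open>Compare y with a known partner y' of x. By \<open>liftable_unique\<close> the quotient
  lies in K or in the coset of b; the first is covered by branching, the second by d, whose states
  are 1 and b.\<close>

lemma N_in_G:
  assumes "x \<in> G" "y \<in> G" "liftable (class_K x) (class_K y)" shows "N s x y \<in> G"
proof -
  have K0: "N False 0 k \<in> G" if "k \<in> K" for k
    using N_K_0_in_G[OF that] N_conj_gA[of False k 0] by (metis G_diff G_plus gens_in_G(1))
  obtain y' where y': "y' \<in> G" "N False x y' \<in> G" using G_partner[OF assms(1)] .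
  have "class_K (y - y') \<in> {0, class_K gB}"
    using liftable_unique[OF assms(3), of "class_K y'"] G_states[OF y'(2)] by (simp add: class_K_diff)
  then have "y - y' \<in> K \<or> y - y' - gB \<in> K"
    using assms y' by (auto simp: K_iff class_K_diff)
  then have "N False 0 (y - y') \<in> G"
  proof
    assume "y - y' - gB \<in> K"
    then have "N False 0 (y - y' - gB) + gD \<in> G" using K0 by simp
    then show ?thesis by (simp add: gens_N(4) N_plus)
  qed (rule K0)
  moreover have "N False 0 (y - y') + N False x y' = N False x y" by (simp add: N_plus)
  ultimately have F: "N False x y \<in> G" using y' by (metis G_plus)
  moreover have "N True x y = N False x y + gA" by (simp add: gens_N(1) N_plus)
  ultimately show ?thesis by (cases s) auto
qed



section \<open>Quadratic equations with constraints modulo K\<close>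

fun constrained :: "(Q \<times> Q) list \<Rightarrow> aut set" where
  "constrained [] = {0}"
| "constrained ((p, q) # ps) = {comm x y + r | x y r. x \<in> G \<and> class_K x = p \<and> y \<in> G \<and> class_K y = q \<and> r \<in> constrained ps}"

fun csum :: "(Q \<times> Q) list \<Rightarrow> Q" where
  "csum [] = 0"
| "csum ((p, q) # ps) = comm p q + csum ps"

lemma constrained_ConsI: "\<lbrakk>x \<in> G; class_K x = p; y \<in> G; class_K y = q; r \<in> constrained ps\<rbrakk> \<Longrightarrow> comm x y + r \<in> constrained ((p, q) # ps)"
  by auto

lemma constrained_ConsE:
  assumes "g \<in> constrained ((p, q) # ps)"
  obtains x y r where "g = comm x y + r" "x \<in> G" "class_K x = p" "y \<in> G" "class_K y = q" "r \<in> constrained ps"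
  using assms by auto

declare constrained.simps(2) [simp del]

lemma constrained_in_G: "r \<in> constrained ps \<Longrightarrow> r \<in> G \<and> class_K r = csum ps"
  by (induction ps arbitrary: r) (auto simp: class_K_plus class_K_comm elim!: constrained_ConsE)

lemma constrained_append: "constrained (ps @ qs) = {r + s | r s. r \<in> constrained ps \<and> s \<in> constrained qs}"
proof (induction ps)
  case (Cons h ps)
  obtain p q where h: "h = (p, q)" by force
  show "constrained ((h # ps) @ qs) = {r + s | r s. r \<in> constrained (h # ps) \<and> s \<in> constrained qs}" (is "?L = ?R")
  proof (intro Set.set_eqI iffI)
    fix g assume "g \<in> ?L"
    then obtain x y r s where "g = comm x y + (r + s)" "x \<in> G" "class_K x = p" "y \<in> G" "class_K y = q" "r \<in> constrained ps" "s \<in> constrained qs"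
      using Cons.IH by (auto simp: h elim!: constrained_ConsE)
    then have "g = (comm x y + r) + s" "comm x y + r \<in> constrained (h # ps)" "s \<in> constrained qs"
      by (auto simp: h add.assoc intro!: constrained_ConsI)
    then show "g \<in> ?R" by blast
  next
    fix g assume "g \<in> ?R"
    then obtain x y r s where "g = (comm x y + r) + s" "x \<in> G" "class_K x = p" "y \<in> G" "class_K y = q" "r \<in> constrained ps" "s \<in> constrained qs"
      by (auto simp: h elim!: constrained_ConsE)
    then show "g \<in> ?L" using Cons.IH constrained_ConsI[of x p y q "r + s" "ps @ qs"] by (auto simp: h add.assoc)
  qed
qed simp

definition conjp :: "Q \<Rightarrow> Q \<times> Q \<Rightarrow> Q \<times> Q" where
  "conjp g h = (g + fst h - g, g + snd h - g)"

lemma comm_conj: "g + comm x y - g = comm (g + x - g) (g + y - g :: 'a :: group_add)"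
  unfolding comm_def by (simp only: free_group)

lemma constrained_conj:
  assumes "r \<in> constrained ps" "g \<in> G" shows "g + r - g \<in> constrained (map (conjp (class_K g)) ps)"
  using assms(1)
proof (induction ps arbitrary: r)
  case (Cons h ps)
  obtain p q where h: "h = (p, q)" by force
  from Cons.prems[unfolded h] obtain x y s where r: "r = comm x y + s" "x \<in> G" "class_K x = p" "y \<in> G" "class_K y = q" "s \<in> constrained ps"
    by (rule constrained_ConsE)
  have "g + r - g = comm (g + x - g) (g + y - g) + (g + s - g)"
    unfolding r(1) comm_conj[symmetric] by (simp only: free_group)
  then show ?case
    using r assms(2) Cons.IH[OF r(6)]
    by (simp only: h list.map conjp_def fst_conv snd_conv) (rule constrained_ConsI, simp_all add: class_K_plus class_K_diff)
qed simp

lemma constrained_conj_iff: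
  assumes "g \<in> G" shows "r \<in> constrained (map (conjp (class_K g)) ps) \<longleftrightarrow> - g + r + g \<in> constrained ps"
proof
  have "map (conjp (- class_K g)) (map (conjp (class_K g)) ps) = ps"
    unfolding map_map by (rule map_idI) (simp add: conjp_def free_group del: add_uminus_conv_diff)
  moreover assume "r \<in> constrained (map (conjp (class_K g)) ps)"
  ultimately show "- g + r + g \<in> constrained ps"
    using constrained_conj[of r "map (conjp (class_K g)) ps" "- g"] assms by (simp add: class_K_uminus del: map_map)
next
  assume "- g + r + g \<in> constrained ps"
  from constrained_conj[OF this assms] show "r \<in> constrained (map (conjp (class_K g)) ps)" by (simp add: free_group del: add_uminus_conv_diff)
qed

subsection \<open>Moves\<close>

text \<open>
  The moves are automorphisms of the free group that fix \<open>[x\<^sub>1, y\<^sub>1] \<cdots> [x\<^sub>n, y\<^sub>n]\<close>; \<open>Swap\<close> has this simple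
  effect on the classes because commutators are central modulo \<open>K\<close>.
\<close>

datatype move = Swap | Twist | Rot | Slide

fun apply_move :: "nat \<Rightarrow> move \<Rightarrow> (Q \<times> Q) list \<Rightarrow> (Q \<times> Q) list" where
  "apply_move (Suc i) m (h # ps) = h # apply_move i m ps"
| "apply_move 0 Swap (h # k # ps) = k # h # ps"
| "apply_move 0 Twist ((p, q) # ps) = (p, q + p) # ps"
| "apply_move 0 Rot ((p, q) # ps) = (p + q - p, - p) # ps"
| "apply_move 0 Slide ((p, q) # (r, s) # ps) =
     (let c = q - p - q + r in (p, c + q) # (c + r - c, s - c) # ps)"
| "apply_move i m ps = ps"

lemma constrained_move: "r \<in> constrained ps \<Longrightarrow> r \<in> constrained (apply_move i m ps)"
proof (induction i m ps arbitrary: r rule: apply_move.induct)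
  case (2 h k ps)
  obtain p q p' q' where hk: "h = (p, q)" "k = (p', q')" by (cases h; cases k)
  from 2 obtain x y x' y' s where r: "r = comm x y + (comm x' y' + s)" "x \<in> G" "class_K x = p" "y \<in> G" "class_K y = q"
    "x' \<in> G" "class_K x' = p'" "y' \<in> G" "class_K y' = q'" "s \<in> constrained ps"
    unfolding hk by (elim constrained_ConsE) blast
  define c where "c = comm x y"
  have c: "c \<in> G" "class_K c + z = z + class_K c" for z
    using r Q_commutator_central by (auto simp: c_def class_K_comm)
  have "class_K (c + z - c) = class_K z" for z using c(2)[of "class_K z"] by (simp add: class_K_plus class_K_diff)
  moreover have "r = comm (c + x' - c) (c + y' - c) + (comm x y + s)"
    unfolding r(1) c_def[symmetric] comm_conj[symmetric] by (simp only: free_group)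
  ultimately show ?case unfolding hk apply_move.simps
    using r c(1) by (simp only:) (rule constrained_ConsI, simp_all add: constrained_ConsI)
next
  case (3 p q ps)
  then obtain x y s where r: "r = comm x y + s" "x \<in> G" "class_K x = p" "y \<in> G" "class_K y = q" "s \<in> constrained ps"
    by (elim constrained_ConsE) blast
  moreover have "comm x y = comm x (y + x)" unfolding comm_def by (simp only: free_group)
  ultimately show ?case by (simp only: apply_move.simps) (rule constrained_ConsI, simp_all add: class_K_plus)
next
  case (4 p q ps)
  then obtain x y s where r: "r = comm x y + s" "x \<in> G" "class_K x = p" "y \<in> G" "class_K y = q" "s \<in> constrained ps"
    by (elim constrained_ConsE) blast
  moreover have "comm x y = comm (x + y - x) (- x)" unfolding comm_def by (simp only: free_group)
  ultimately show ?case by (simp only: apply_move.simps) (rule constrained_ConsI, simp_all add: class_K_plus class_K_diff class_K_uminus)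
next
  case (5 p q p' q' ps)
  then obtain x y x' y' s where r: "r = comm x y + (comm x' y' + s)" "x \<in> G" "class_K x = p" "y \<in> G" "class_K y = q"
    "x' \<in> G" "class_K x' = p'" "y' \<in> G" "class_K y' = q'" "s \<in> constrained ps"
    by (elim constrained_ConsE) blast
  define c where "c = y - x - y + x'"
  have c: "c \<in> G" "class_K c = q - p - q + p'" using r by (auto simp: c_def class_K_plus class_K_diff)
  have "r = comm x (c + y) + (comm (c + x' - c) (y' - c) + s)"
    unfolding r(1) c_def comm_def by (simp only: free_group)
  then show ?case using r c
    by (simp only: apply_move.simps Let_def) (rule constrained_ConsI, simp_all add: constrained_ConsI class_K_plus class_K_diff)
qed (auto elim!: constrained_ConsE intro!: constrained_ConsI)

fun apply_moves :: "(nat \<times> move) list \<Rightarrow> (Q \<times> Q) list \<Rightarrow> (Q \<times> Q) list" where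
  "apply_moves [] ps = ps"
| "apply_moves ((i, m) # ms) ps = apply_moves ms (apply_move i m ps)"

lemma constrained_moves: "r \<in> constrained ps \<Longrightarrow> r \<in> constrained (apply_moves ms ps)"
  by (induction ms ps rule: apply_moves.induct) (auto intro: constrained_move)

fun trivial_handle :: "Q \<times> Q \<Rightarrow> bool" where
  "trivial_handle (p, q) \<longleftrightarrow> p = 0 \<or> q = 0"

text \<open>The second list arises from the first by inserting handles in which one unknown can be
  put equal to 1. This is how genus 5 returns to genus 3.\<close>

fun extends :: "(Q \<times> Q) list \<Rightarrow> (Q \<times> Q) list \<Rightarrow> bool" where
  "extends ps [] \<longleftrightarrow> ps = []"
| "extends ps (k # qs) \<longleftrightarrow>
     (case ps of [] \<Rightarrow> False | h # ps' \<Rightarrow> h = k \<and> extends ps' qs) \<or> trivial_handle k \<and> extends ps qs"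

lemma constrained_extends: "\<lbrakk>extends ps qs; r \<in> constrained ps\<rbrakk> \<Longrightarrow> r \<in> constrained qs"
proof (induction ps qs arbitrary: r rule: extends.induct)
  case (2 ps k qs)
  obtain p q where k: "k = (p, q)" by force
  from "2.prems"(1) consider ps' where "ps = k # ps'" "extends ps' qs" | "trivial_handle k" "extends ps qs"
    by (auto split: list.splits)
  then show ?case
  proof cases
    case 1
    then show ?thesis using "2.prems"(2) "2.IH"(1)[of k ps'] by (auto simp: k elim!: constrained_ConsE intro!: constrained_ConsI)
  next
    case 2
    have "comm x 0 = 0" "comm 0 x = 0" for x :: aut by (auto simp: comm_def)
    moreover have r: "r \<in> constrained qs" using 2 "2.IH"(2) "2.prems"(2) by blast
    ultimately have "r \<in> constrained ((0, q) # qs)" "r \<in> constrained ((p, 0) # qs)"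
      using constrained_ConsI[of 0 0 "rep q" q r qs] constrained_ConsI[of "rep p" p 0 0 r qs] by simp_all
    then show ?thesis using 2(1) by (auto simp: k)
  qed
qed simp

subsection \<open>Reduction to the states\<close>

text \<open>A quadruple \<open>((y, z), (y', z'))\<close> gives the classes of the states of \<open>\<llangle>y, z\<rrangle>\<close> and \<open>\<llangle>y', z'\<rrangle>\<close>.\<close>

type_synonym quad = "(Q \<times> Q) \<times> (Q \<times> Q)"

fun quad_up :: "quad \<Rightarrow> Q \<times> Q" where "quad_up ((y, z), (y', z')) = (lift_class False y z, lift_class False y' z')"
fun quad_fst :: "quad \<Rightarrow> Q \<times> Q" where "quad_fst ((y, z), (y', z')) = (y, y')"
fun quad_snd :: "quad \<Rightarrow> Q \<times> Q" where "quad_snd ((y, z), (y', z')) = (z, z')"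
fun quad_liftable :: "quad \<Rightarrow> bool" where "quad_liftable ((y, z), (y', z')) \<longleftrightarrow> liftable y z \<and> liftable y' z'"

lemma comm_N_inactive: "comm (N False x y) (N False u v) = N False (comm x u) (comm y v)"
  unfolding comm_def diff_conv_add_uminus by (simp only: N_plus N_uminus if_False simp_thms not_False_eq_True)

lemma constrained_quads:
  "\<lbrakk>r \<in> constrained (map quad_fst L); s \<in> constrained (map quad_snd L); \<forall>l\<in>set L. quad_liftable l\<rbrakk>
    \<Longrightarrow> N False r s \<in> constrained (map quad_up L)"
proof (induction L arbitrary: r s)
  case (Cons l L)
  obtain y z y' z' where l: "l = ((y, z), (y', z'))" by (metis surj_pair)
  from Cons.prems(1) obtain u u' r' where r: "r = comm u u' + r'" "u \<in> G" "class_K u = y" "u' \<in> G" "class_K u' = y'"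
    "r' \<in> constrained (map quad_fst L)" by (auto simp: l elim!: constrained_ConsE)
  from Cons.prems(2) obtain v v' s' where s: "s = comm v v' + s'" "v \<in> G" "class_K v = z" "v' \<in> G" "class_K v' = z'"
    "s' \<in> constrained (map quad_snd L)" by (auto simp: l elim!: constrained_ConsE)
  have "N False r s = comm (N False u v) (N False u' v') + N False r' s'"
    unfolding r(1) s(1) comm_N_inactive by (simp add: N_plus)
  moreover have "N False u v \<in> G" "N False u' v' \<in> G" using r s Cons.prems(3) by (auto simp: l intro: N_in_G)
  ultimately show ?case
    using r s Cons.IH[OF r(6) s(6)] Cons.prems(3)
    by (simp only: l list.map quad_up.simps) (rule constrained_ConsI, simp_all add: class_K_N)
qed (simp add: N_zero)

text \<open>
  If \<open>x\<^sub>1\<close> exchanges the two subtrees and the other unknowns do not, then the equation between the first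
  states can be solved for the first state of \<open>y\<^sub>1\<close>. Substituting it into the equation between the second
  states leaves an equation of genus \<open>2n - 1\<close> for \<open>h g\<^sub>1 h\<^sup>-\<^sup>1 g\<^sub>2\<close>, where \<open>h\<close> is the second state of \<open>x\<^sub>1\<close>.
\<close>

lemma constrained_reduce:
  assumes G: "g\<^sub>1 \<in> G" "g\<^sub>2 \<in> G" "h \<in> G" "class_K h = p\<^sub>2"
    and h: "h + g\<^sub>1 - h + g\<^sub>2 \<in> constrained ((p\<^sub>2 + p\<^sub>1, q\<^sub>2) # map quad_snd L @ map (conjp (- class_K g\<^sub>2 + p\<^sub>2)) (map quad_fst L))"
    and q: "q\<^sub>1 = csum (map quad_fst L) - class_K g\<^sub>1 + p\<^sub>1 + q\<^sub>2 - p\<^sub>1"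
    and liftable: "liftable p\<^sub>1 p\<^sub>2" "liftable q\<^sub>1 q\<^sub>2" "\<forall>l\<in>set L. quad_liftable l"
  shows "N False g\<^sub>1 g\<^sub>2 \<in> constrained ((lift_class True p\<^sub>1 p\<^sub>2, lift_class False q\<^sub>1 q\<^sub>2) # map quad_up L)"
proof -
  from h obtain w v \<zeta> \<eta>' where
    w: "w \<in> G" "class_K w = p\<^sub>2 + p\<^sub>1" and v: "v \<in> G" "class_K v = q\<^sub>2" and \<zeta>: "\<zeta> \<in> constrained (map quad_snd L)"
    and \<eta>': "\<eta>' \<in> constrained (map (conjp (- class_K g\<^sub>2 + p\<^sub>2)) (map quad_fst L))"
    and eq: "h + g\<^sub>1 - h + g\<^sub>2 = comm w v + (\<zeta> + \<eta>')"
    by (elim constrained_ConsE) (auto simp: constrained_append)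
  \<comment> \<open>\<open>\<eta>\<close> is the product of the remaining commutators of the first
    states. Eliminating the state \<open>u\<close> moves it to the end of the second equation, past
    \<open>g\<^sub>2\<close>, hence the conjugation. Likewise \<open>w\<close> stands for the
    product of \<open>h\<close> and \<open>y\<close>, so \<open>y\<close> is recovered from
    it.\<close>
  define \<eta> where "\<eta> = - (- g\<^sub>2 + h) + \<eta>' + (- g\<^sub>2 + h)"
  have \<eta>: "\<eta> \<in> constrained (map quad_fst L)"
    using \<eta>' constrained_conj_iff[of "- g\<^sub>2 + h" \<eta>' "map quad_fst L"] G by (simp add: \<eta>_def class_K_plus class_K_uminus)
  define y where "y = - h + w"
  define u where "u = \<eta> - g\<^sub>1 + y + v - y"
  have y: "y \<in> G" "class_K y = p\<^sub>1" using w G by (auto simp: y_def class_K_plus class_K_uminus)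
  have u: "u \<in> G" "class_K u = q\<^sub>1" using y v G constrained_in_G[OF \<eta>] by (auto simp: u_def class_K_plus class_K_diff q)
  have "\<eta>' = (- g\<^sub>2 + h) + \<eta> - (- g\<^sub>2 + h)" unfolding \<eta>_def by (simp only: free_group)
  then have "h + g\<^sub>1 - h + g\<^sub>2 = comm w v + (\<zeta> + ((- g\<^sub>2 + h) + \<eta> - (- g\<^sub>2 + h)))" using eq by simp
  then have "(h + g\<^sub>1 - h + g\<^sub>2) + (- g\<^sub>2 + h - \<eta> - h + g\<^sub>2) = comm w v + \<zeta>"
    by (simp only: free_group)
  then have cw: "comm w v + \<zeta> = h + g\<^sub>1 - \<eta> - h + g\<^sub>2" by (simp only: free_group)
  have "comm (N True y h) (N False u v) = N False (y + v - y - u) (h + u - h - v)"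
    unfolding comm_def diff_conv_add_uminus by (simp add: N_plus N_uminus del: add_uminus_conv_diff)
  moreover have "(y + v - y - u) + \<eta> = g\<^sub>1" unfolding u_def by (simp only: free_group)
  moreover have "(h + u - h - v) + \<zeta> = g\<^sub>2"
  proof -
    have "(h + u - h - v) + \<zeta> = (h + \<eta> - g\<^sub>1 - h) + (comm w v + \<zeta>)"
      unfolding u_def y_def comm_def by (simp only: free_group)
    then show ?thesis unfolding cw by (simp only: free_group)
  qed
  ultimately have "N False g\<^sub>1 g\<^sub>2 = comm (N True y h) (N False u v) + N False \<eta> \<zeta>"
    by (simp add: N_plus)
  then show ?thesis
    using constrained_quads[OF \<eta> \<zeta> liftable(3)] N_in_G[of y h True] N_in_G[of u v False] class_K_N[of y h True] class_K_N[of u v False]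
      G u v y liftable by (simp only:) (rule constrained_ConsI, simp_all)
qed



section \<open>Words\<close>

datatype letter = A | B | C | D

type_synonym word = "letter list"

fun lval :: "letter \<Rightarrow> aut" where "lval A = gA" | "lval B = gB" | "lval C = gC" | "lval D = gD"

fun val :: "word \<Rightarrow> aut" where "val [] = 0" | "val (l # w) = lval l + val w"

fun lclass :: "letter \<Rightarrow> Q" where
  "lclass A = Q True False False False" | "lclass B = Q False False False True"
| "lclass C = Q False False True True" | "lclass D = Q False False True False"

fun wclass :: "word \<Rightarrow> Q" where "wclass [] = 0" | "wclass (l # w) = lclass l + wclass w"

lemma lval_in_G [simp]: "lval l \<in> G"
  by (cases l) auto

lemma val_in_G [simp]: "val w \<in> G"
  by (induction w) auto

lemma class_K_lval: "class_K (lval l) = lclass l"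
  by (cases l) (auto simp: class_K_gens)

lemma class_K_val: "class_K (val w) = wclass w"
  by (induction w) (auto simp: class_K_plus class_K_lval)

lemma val_append: "val (u @ w) = val u + val w"
  by (induction u) (auto simp: add.assoc)

lemma G_val: "x \<in> G \<Longrightarrow> \<exists>w. x = val w"
proof (induction rule: G.induct)
  case zero_in_G
  show ?case by (rule exI[of _ "[]"]) simp
next
  case (G_step x g)
  then obtain w l where "x = val w" "g = lval l" by (metis empty_iff insert_iff lval.simps)
  then show ?case by (intro exI[of _ "w @ [l]"]) (simp add: val_append)
qed

section \<open>Certified reductions\<close>

text \<open>
  An entry \<open>(\<tau>, u\<^sub>1, u\<^sub>2, v, h\<^sub>0, h\<^sub>1)\<close> reduces the constraint \<open>\<tau>\<close> for \<open>\<llangle>g\<^sub>1, g\<^sub>2\<rrangle>\<close> with \<open>g\<^sub>i \<in> u\<^sub>i K\<close>, with \<open>v\<close>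
  as second state of the first unknown; \<open>h\<^sub>0\<close> and \<open>h\<^sub>1\<close> serve for \<open>v g\<^sub>1 v\<^sup>-\<^sup>1 g\<^sub>2\<close> inside and outside \<open>[K, G]\<close>.
  In \<open>(w\<^sub>1, w\<^sub>2, L, \<sigma>, ms)\<close> the word \<open>w\<^sub>1\<close> is the class of the first state of the first unknown, \<open>w\<^sub>2\<close> that
  of the second state of the second unknown, \<open>L\<close> gives the states of the others, and the moves \<open>ms\<close>
  lead from \<open>\<sigma>\<close> to the resulting constraint. The entries were found by a computer search.
\<close>

type_synonym handles = "(word \<times> word) list"
type_synonym half = "word \<times> word \<times> ((word \<times> word) \<times> (word \<times> word)) list \<times> handles \<times> (nat \<times> move) list"
type_synonym entry = "handles \<times> word \<times> word \<times> word \<times> half \<times> half"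

definition hclass :: "handles \<Rightarrow> (Q \<times> Q) list" where "hclass = map (map_prod wclass wclass)"

fun half_ok :: "handles \<Rightarrow> word \<Rightarrow> word \<Rightarrow> word \<Rightarrow> half \<Rightarrow> bool" where
  "half_ok \<tau> u\<^sub>1 u\<^sub>2 v (w\<^sub>1, w\<^sub>2, L, \<sigma>, ms) \<longleftrightarrow>
     (let p\<^sub>1 = wclass w\<^sub>1; p\<^sub>2 = wclass v; q\<^sub>2 = wclass w\<^sub>2; L' = map (map_prod (map_prod wclass wclass) (map_prod wclass wclass)) L;
          q\<^sub>1 = csum (map quad_fst L') - wclass u\<^sub>1 + p\<^sub>1 + q\<^sub>2 - p\<^sub>1
      in liftable p\<^sub>1 p\<^sub>2 \<and> liftable q\<^sub>1 q\<^sub>2 \<and> list_all quad_liftable L' \<and>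
         hclass \<tau> = (lift_class True p\<^sub>1 p\<^sub>2, lift_class False q\<^sub>1 q\<^sub>2) # map quad_up L' \<and>
         p\<^sub>2 + wclass u\<^sub>1 - p\<^sub>2 + wclass u\<^sub>2 = 0 \<and>
         extends (apply_moves ms (hclass \<sigma>))
           ((p\<^sub>2 + p\<^sub>1, q\<^sub>2) # map quad_snd L' @ map (conjp (- wclass u\<^sub>2 + p\<^sub>2)) (map quad_fst L')))"

lemma half_sound:
  assumes ok: "half_ok \<tau> u\<^sub>1 u\<^sub>2 v (w\<^sub>1, w\<^sub>2, L, \<sigma>, ms)"
    and g: "g\<^sub>1 \<in> G" "g\<^sub>2 \<in> G" "class_K g\<^sub>1 = wclass u\<^sub>1" "class_K g\<^sub>2 = wclass u\<^sub>2"
    and h: "val v + g\<^sub>1 - val v + g\<^sub>2 \<in> constrained (hclass \<sigma>)"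
  shows "N False g\<^sub>1 g\<^sub>2 \<in> constrained (hclass \<tau>)"
proof -
  define L' where "L' = map (map_prod (map_prod wclass wclass) (map_prod wclass wclass)) L"
  define q\<^sub>1 where "q\<^sub>1 = csum (map quad_fst L') - wclass u\<^sub>1 + wclass w\<^sub>1 + wclass w\<^sub>2 - wclass w\<^sub>1"
  note * = ok[unfolded half_ok.simps Let_def, folded L'_def, folded q\<^sub>1_def]
  have "N False g\<^sub>1 g\<^sub>2 \<in> constrained ((lift_class True (wclass w\<^sub>1) (wclass v), lift_class False q\<^sub>1 (wclass w\<^sub>2)) # map quad_up L')"
  proof (rule constrained_reduce[where h = "val v"])
    show "val v + g\<^sub>1 - val v + g\<^sub>2 \<in> constrained ((wclass v + wclass w\<^sub>1, wclass w\<^sub>2) # map quad_snd L' @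
        map (conjp (- class_K g\<^sub>2 + wclass v)) (map quad_fst L'))"
      unfolding g(4) using constrained_extends constrained_moves[OF h] * by blast
    show "\<forall>l\<in>set L'. quad_liftable l" using * by (simp add: list_all_iff)
    show "q\<^sub>1 = csum (map quad_fst L') - class_K g\<^sub>1 + wclass w\<^sub>1 + wclass w\<^sub>2 - wclass w\<^sub>1" unfolding q\<^sub>1_def g(3) ..
  qed (use g * in \<open>simp_all add: class_K_val\<close>)
  then show ?thesis using * by simp
qed

fun entry_ok :: "(bool \<Rightarrow> handles list) \<Rightarrow> entry \<Rightarrow> bool" where
  "entry_ok S (\<tau>, u\<^sub>1, u\<^sub>2, v, h\<^sub>0, h\<^sub>1) \<longleftrightarrow>
     half_ok \<tau> u\<^sub>1 u\<^sub>2 v h\<^sub>0 \<and> fst (snd (snd (snd h\<^sub>0))) \<in> set (S False) \<and>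
     half_ok \<tau> u\<^sub>1 u\<^sub>2 v h\<^sub>1 \<and> fst (snd (snd (snd h\<^sub>1))) \<in> set (S True)"

text \<open>For \<open>h \<in> K\<close> the action of the states of \<open>h\<close> tells whether \<open>h\<close> lies in \<open>[K, G]\<close>, of index 2 in \<open>K\<close>.\<close>

definition odd_class :: "aut \<Rightarrow> bool" where "odd_class h \<longleftrightarrow> act (sec0 h)"

definition solvable :: "(bool \<Rightarrow> handles list) \<Rightarrow> aut \<Rightarrow> bool" where
  "solvable S h \<longleftrightarrow> (\<forall>\<sigma>\<in>set (S (odd_class h)). h \<in> constrained (hclass \<sigma>))"

lemma entry_sound:
  assumes ok: "entry_ok S (\<tau>, u\<^sub>1, u\<^sub>2, v, h\<^sub>0, h\<^sub>1)"
    and g: "g\<^sub>1 \<in> G" "g\<^sub>2 \<in> G" "class_K g\<^sub>1 = wclass u\<^sub>1" "class_K g\<^sub>2 = wclass u\<^sub>2"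
    and h: "val v + g\<^sub>1 - val v + g\<^sub>2 \<in> K \<Longrightarrow> solvable S (val v + g\<^sub>1 - val v + g\<^sub>2)"
  shows "N False g\<^sub>1 g\<^sub>2 \<in> constrained (hclass \<tau>)"
proof -
  define h' where "h' = val v + g\<^sub>1 - val v + g\<^sub>2"
  obtain w\<^sub>1 w\<^sub>2 L \<sigma> ms where h\<^sub>0: "h\<^sub>0 = (w\<^sub>1, w\<^sub>2, L, \<sigma>, ms)" by (metis surj_pair)
  obtain x\<^sub>1 x\<^sub>2 M \<rho> ns where h\<^sub>1: "h\<^sub>1 = (x\<^sub>1, x\<^sub>2, M, \<rho>, ns)" by (metis surj_pair)
  have "wclass v + wclass u\<^sub>1 - wclass v + wclass u\<^sub>2 = 0" using ok by (simp add: h\<^sub>0 Let_def)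
  then have "h' \<in> K" using g by (simp add: h'_def K_iff class_K_plus class_K_diff class_K_val)
  then have "solvable S h'" using h by (simp add: h'_def)
  then show ?thesis
    using ok half_sound[OF _ g, of \<tau> v w\<^sub>1 w\<^sub>2 L \<sigma> ms] half_sound[OF _ g, of \<tau> v x\<^sub>1 x\<^sub>2 M \<rho> ns]
    by (cases "odd_class h'") (auto simp: solvable_def h\<^sub>0 h\<^sub>1 h'_def[symmetric] simp del: half_ok.simps)
qed

text \<open>The pairs (ca)^m, (ac)^m for m = 0, 1, 2, 3, since ca has order 4 modulo K; the Boolean
  is the parity of m.\<close>

definition K_states :: "(bool \<times> word \<times> word) list" where
  "K_states = [(False, [], []), (True, [C,A], [A,C]), (False, [A,C,A,C], [A,C,A,C]), (True, [A,C], [C,A])]"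

lemma K_cases:
  assumes "g \<in> K"
  obtains g\<^sub>1 g\<^sub>2 u\<^sub>1 u\<^sub>2 where "g = N False g\<^sub>1 g\<^sub>2" "g\<^sub>1 \<in> G" "g\<^sub>2 \<in> G" "class_K g\<^sub>1 = wclass u\<^sub>1" "class_K g\<^sub>2 = wclass u\<^sub>2"
    "(odd_class g, u\<^sub>1, u\<^sub>2) \<in> set K_states"
proof -
  have "g \<in> G" "class_K g = 0" using assms by (auto simp: K_iff)
  then obtain s g\<^sub>1 g\<^sub>2 where g: "g = N s g\<^sub>1 g\<^sub>2" "g\<^sub>1 \<in> G" "g\<^sub>2 \<in> G" "liftable (class_K g\<^sub>1) (class_K g\<^sub>2)" "lift_class s (class_K g\<^sub>1) (class_K g\<^sub>2) = 0"
    using G_cases[of g] by metis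
  obtain t k\<^sub>1 k\<^sub>2 e where q1: "class_K g\<^sub>1 = Q t k\<^sub>1 k\<^sub>2 e" by (cases "class_K g\<^sub>1")
  obtain u m\<^sub>1 m\<^sub>2 f where q2: "class_K g\<^sub>2 = Q u m\<^sub>1 m\<^sub>2 f" by (cases "class_K g\<^sub>2")
  have "odd_class g = t" using g(1) q1 by (simp add: odd_class_def class_K_def)
  moreover have "\<not> s" using g(5) by (simp add: q1 q2 zero_Q_def)
  moreover have "\<exists>(t', u\<^sub>1, u\<^sub>2)\<in>set K_states. t' = t \<and> class_K g\<^sub>1 = wclass u\<^sub>1 \<and> class_K g\<^sub>2 = wclass u\<^sub>2"
    using g(4,5) unfolding q1 q2
    by (cases t; cases k\<^sub>1; cases k\<^sub>2) (auto simp: K_states_def zero_Q_def)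
  ultimately show thesis using that g(1-3) by fastforce
qed

definition covers :: "(bool \<Rightarrow> handles list) \<Rightarrow> entry list \<Rightarrow> bool" where
  "covers S es \<longleftrightarrow> (\<forall>(s, u\<^sub>1, u\<^sub>2)\<in>set K_states. \<forall>\<tau>\<in>set (S s).
     \<exists>(\<tau>', u\<^sub>1', u\<^sub>2', e)\<in>set es. \<tau>' = \<tau> \<and> u\<^sub>1' = u\<^sub>1 \<and> u\<^sub>2' = u\<^sub>2)"

lemma solvable_by_table:
  assumes "list_all (entry_ok S) es" "covers T es"
    and S: "\<And>h. h \<in> K \<Longrightarrow> solvable S h" and g: "g \<in> K"
  shows "solvable T g"
  unfolding solvable_def
proof
  fix \<tau> assume \<tau>: "\<tau> \<in> set (T (odd_class g))"
  obtain g\<^sub>1 g\<^sub>2 u\<^sub>1 u\<^sub>2 where *: "g = N False g\<^sub>1 g\<^sub>2" "g\<^sub>1 \<in> G" "g\<^sub>2 \<in> G" "class_K g\<^sub>1 = wclass u\<^sub>1" "class_K g\<^sub>2 = wclass u\<^sub>2"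
    "(odd_class g, u\<^sub>1, u\<^sub>2) \<in> set K_states" using K_cases[OF g] .
  then obtain v h\<^sub>0 h\<^sub>1 where "(\<tau>, u\<^sub>1, u\<^sub>2, v, h\<^sub>0, h\<^sub>1) \<in> set es"
    using assms(2) \<tau> unfolding covers_def by fastforce
  then have "entry_ok S (\<tau>, u\<^sub>1, u\<^sub>2, v, h\<^sub>0, h\<^sub>1)" using assms(1) unfolding list_all_iff by blast
  then show "g \<in> constrained (hclass \<tau>)" unfolding *(1) by (rule entry_sound) (use * S in auto)
qed

text \<open>A name with E is for right-hand sides in [K, G], one with O for those in K outside it;
  the handle with second entry b in each O system pairs it with a word containing a.
  \<open>Z1\<close> and \<open>Z3\<close> are for the coset of (ad)^2, with m even and odd
  respectively in the states b(ca)^m, b(ac)^m.\<close>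

definition E1 :: "(word \<times> word) list" where "E1 = [([A], []), ([B], []), ([D], [])]"
definition E2 :: "(word \<times> word) list" where "E2 = [([A], []), ([D], [B]), ([B], [])]"
definition O1 :: "(word \<times> word) list" where "O1 = [([A], [B]), ([D], []), ([B], [])]"
definition O2 :: "(word \<times> word) list" where "O2 = [([A,D], [B]), ([D], []), ([B], [])]"
definition KE :: "(word \<times> word) list" where "KE = [([D,A], []), ([B], []), ([], [])]"
definition KO :: "(word \<times> word) list" where "KO = [([D,A], [B]), ([B], []), ([], [])]"
definition KK :: "(word \<times> word) list" where "KK = [([C,A], []), ([], [])]"
definition GE :: "(word \<times> word) list" where "GE = [([A], []), ([D], [B])]"
definition GO :: "(word \<times> word) list" where "GO = [([A], [B]), ([D], [])]"
definition Z1 :: "(word \<times> word) list" where "Z1 = [([A], [D]), ([D], [B])]"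
definition Z3 :: "(word \<times> word) list" where "Z3 = [([A], [C]), ([D], [])]"

definition core_table :: "entry list" where
  "core_table =
    [(E1, [], [], [],
      ([], [], [(([C], [A]), ([], [])), (([], [B]), ([], []))], E1,
        [(1,Twist), (2,Rot), (1,Slide), (2,Rot)]),
      ([], [], [(([A], [C]), ([], [])), (([], [B]), ([A,C], [C,A]))], O2,
        [(0,Swap), (1,Twist), (0,Rot), (2,Rot), (1,Slide), (1,Rot), (0,Slide), (0,Rot)])),
     (E1, [A,C,A,C], [A,C,A,C], [],
      ([], [C,A], [(([C], [A]), ([], [])), (([], [B]), ([], []))], E1,
        [(1,Twist), (2,Rot), (1,Slide), (2,Rot)]),
      ([], [C,A], [(([A], [C]), ([], [])), (([], [B]), ([A,C], [C,A]))], O2,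
        [(0,Swap), (1,Twist), (0,Rot), (2,Rot), (1,Slide), (1,Rot), (0,Slide), (0,Rot)])),
     (E2, [], [], [],
      ([], [], [(([], [B]), ([A], [C])), (([A], [C]), ([], []))], E2,
        [(0,Swap), (1,Swap), (0,Swap), (0,Rot), (1,Rot), (0,Slide)]),
      ([], [], [(([], [B]), ([C], [A])), (([C], [A]), ([], []))], O1,
        [(1,Swap), (0,Twist), (2,Rot), (0,Slide), (1,Slide), (0,Swap)])),
     (E2, [A,C,A,C], [A,C,A,C], [],
      ([], [C,A], [(([], [B]), ([A], [C])), (([A], [C]), ([], []))], E2,
        [(0,Rot), (0,Slide), (1,Swap), (2,Rot), (0,Slide), (1,Slide)]),
      ([], [C,A], [(([], [B]), ([C], [A])), (([A], [C]), ([], []))], O1,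
        [(1,Rot), (0,Slide), (0,Swap), (1,Swap), (0,Slide), (1,Slide)])),
     (O1, [C,A], [A,C], [],
      ([], [C], [(([], [B]), ([], [])), (([C,A,C], [A,C,A]), ([], []))], E1,
        [(0,Swap), (1,Swap), (0,Swap), (1,Twist), (0,Rot), (0,Slide)]),
      ([], [C], [(([], [B]), ([A,C], [C,A])), (([A], [C]), ([], []))], O2,
        [(0,Swap), (1,Twist), (0,Rot), (2,Rot), (1,Slide), (1,Rot), (0,Slide)])),
     (O1, [A,C], [C,A], [],
      ([], [A], [(([], [B]), ([], [])), (([A], [C]), ([], []))], E1,
        [(1,Twist), (0,Rot), (2,Rot), (1,Slide), (2,Rot)]),
      ([], [C,A,C], [(([], [B]), ([A,C], [C,A])), (([A], [C]), ([], []))], O2,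
        [(2,Twist), (1,Rot), (0,Slide), (0,Swap), (1,Swap), (2,Rot), (1,Slide), (2,Rot)])),
     (O2, [C,A], [A,C], [],
      ([B], [C], [(([], [B]), ([], [])), (([C,A,C], [A,C,A]), ([], []))], E2,
        [(0,Swap), (1,Swap), (0,Rot), (0,Twist)]),
      ([B], [C], [(([], [B]), ([A,C], [C,A])), (([A], [C]), ([], []))], O1,
        [(1,Swap), (0,Rot), (0,Twist), (1,Slide), (0,Swap), (2,Rot), (1,Slide)])),
     (O2, [A,C], [C,A], [],
      ([B], [C], [(([], [B]), ([], [])), (([C], [A]), ([C,A], [A,C]))], E2,
        [(1,Swap), (1,Twist), (2,Twist), (2,Rot), (1,Slide), (0,Swap), (1,Slide)]),
      ([B], [A], [(([], [B]), ([], [])), (([A], [C]), ([], []))], O1,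
        [(1,Swap), (1,Twist), (0,Rot), (2,Rot), (1,Slide), (2,Rot)]))]"

definition K_table :: "entry list" where
  "K_table =
    [(KE, [], [], [B],
      ([], [], [(([C], [A]), ([], [])), (([], []), ([], []))], E1,
        [(1,Twist), (2,Rot), (1,Slide), (0,Swap), (2,Rot)]),
      ([], [C,A], [(([A], [C]), ([A,C], [C,A])), (([], []), ([], []))], O2,
        [(0,Twist), (0,Slide), (1,Swap), (0,Rot), (0,Twist), (2,Rot), (0,Slide), (1,Slide), (0,Swap)])),
     (KE, [A,C,A,C], [A,C,A,C], [A,D],
      ([C,A], [], [(([C], [A]), ([C,A], [A,C])), (([], []), ([], []))], E1,
        [(1,Twist), (2,Rot), (1,Slide), (0,Swap), (2,Rot), (1,Slide)]),
      ([C,A], [C,A], [(([A], [C]), ([], [])), (([], []), ([], []))], O2,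
        [(0,Twist), (1,Rot), (2,Rot), (0,Slide), (1,Swap), (0,Rot), (2,Rot), (0,Slide)])),
     (KO, [C,A], [A,C], [B],
      ([], [C], [(([C,A,C], [A,C,A]), ([], [])), (([], []), ([], []))], E2,
        [(1,Rot), (2,Rot), (1,Slide), (0,Swap)]),
      ([], [C,A,C], [(([C], [A]), ([C,A], [A,C])), (([], []), ([], []))], O1,
        [(0,Twist), (1,Rot), (1,Slide), (1,Rot), (0,Slide), (1,Swap), (0,Slide), (0,Swap)])),
     (KO, [A,C], [C,A], [B],
      ([], [C], [(([C], [A]), ([C,A], [A,C])), (([], []), ([], []))], E2,
        [(1,Swap), (1,Twist), (2,Twist), (2,Rot), (1,Slide), (0,Swap), (1,Slide)]),
      ([], [A], [(([C,A,C], [A,C,A]), ([], [])), (([], []), ([C,A], [A,C]))], O1,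
        [(1,Swap), (2,Rot), (0,Slide), (1,Slide), (0,Swap), (1,Slide)]))]"

definition KK_table :: "entry list" where
  "KK_table =
    [(KK, [], [], [D],
      ([A], [A,C,A,C], [(([], []), ([A,C], [C,A]))], KE,
        [(1,Twist), (1,Slide), (1,Rot), (0,Slide), (1,Swap), (0,Slide)]),
      ([A], [A,C], [(([A,C], [C,A]), ([], []))], KO,
        [(1,Rot), (0,Slide), (1,Rot), (1,Twist), (1,Slide), (2,Rot)]))]"

definition G_table :: "entry list" where
  "G_table =
    [(GE, [], [], [],
      ([], [], [(([], [B]), ([A], [C]))], E2,
        [(0,Swap), (1,Swap), (0,Swap), (0,Rot), (1,Rot), (2,Rot), (0,Slide)]),
      ([], [], [(([], [B]), ([C], [A]))], O1,
        [(1,Swap), (0,Swap), (0,Rot), (1,Rot), (2,Rot), (0,Slide), (1,Slide)])),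
     (GE, [A,C,A,C], [A,C,A,C], [],
      ([], [C,A], [(([], [B]), ([A], [C]))], E2,
        [(0,Swap), (0,Rot), (0,Slide), (1,Swap), (0,Rot), (0,Twist), (0,Slide), (0,Rot), (1,Slide), (2,Rot)]),
      ([], [A,C], [(([], [B]), ([C], [A]))], O1,
        [(0,Rot), (2,Rot), (0,Slide), (0,Rot), (0,Twist), (1,Slide), (1,Rot), (0,Slide), (0,Rot)])),
     (GO, [C,A], [A,C], [],
      ([], [C], [(([A,C], [D,A]), ([], []))], E1,
        [(1,Slide), (0,Swap), (0,Rot), (2,Rot), (2,Twist), (1,Slide), (1,Rot), (2,Rot), (2,Twist), (0,Slide), (1,Swap), (0,Slide), (0,Rot)]),
      ([], [C], [(([], [B]), ([A,C], [C,A]))], O2,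
        [(0,Swap), (1,Twist), (0,Rot), (2,Rot), (1,Slide), (1,Rot), (0,Slide)])),
     (GO, [A,C], [C,A], [],
      ([], [A], [(([A,C], [D,A]), ([], []))], E1,
        [(2,Twist), (1,Rot), (0,Slide), (1,Swap), (0,Slide), (1,Slide), (1,Rot), (2,Rot), (0,Slide), (0,Rot)]),
      ([], [C,A,C], [(([], [B]), ([A,C], [C,A]))], O2,
        [(2,Twist), (1,Rot), (0,Slide), (0,Swap), (1,Swap), (2,Rot), (1,Slide), (2,Rot)])),
     (Z1, [B], [B], [],
      ([], [B], [(([], [B]), ([A], [C]))], E2,
        [(0,Swap), (1,Swap), (0,Swap), (0,Rot), (1,Rot), (1,Twist), (2,Rot)]),
      ([], [B], [(([], [B]), ([C], [A]))], O1,
        [(1,Swap), (0,Swap), (0,Rot), (1,Rot), (1,Twist), (2,Rot), (1,Slide)])),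
     (Z1, [A,C,A,D], [A,C,A,D], [],
      ([], [D,A], [(([], [B]), ([A], [C]))], E2,
        [(0,Twist), (1,Twist), (1,Slide), (1,Rot), (0,Slide), (0,Swap), (1,Swap), (2,Rot)]),
      ([], [D,A], [(([], [B]), ([C], [A]))], O1,
        [(0,Twist), (1,Twist), (2,Rot), (1,Slide), (1,Rot), (0,Slide), (0,Swap), (1,Rot)])),
     (Z3, [D,A], [A,D], [],
      ([], [D], [(([A,C], [D,A]), ([], []))], E1,
        [(0,Twist), (1,Rot), (0,Slide), (1,Swap), (0,Rot), (0,Slide), (0,Rot), (1,Slide), (0,Swap), (0,Rot), (2,Rot)]),
      ([], [D], [(([], [B]), ([A,C], [C,A]))], O2,
        [(0,Swap), (1,Twist), (0,Rot), (2,Rot), (1,Slide), (1,Rot), (1,Twist)])),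
     (Z3, [A,D], [D,A], [],
      ([], [A,B], [(([A,C], [D,A]), ([A,C,A,C], [A,C,A,C]))], E1,
        [(1,Twist), (2,Twist), (0,Slide), (1,Swap), (0,Rot), (0,Slide), (1,Slide), (1,Rot), (2,Rot), (0,Slide), (0,Rot), (1,Slide)]),
      ([], [C,A,D], [(([], [B]), ([A,C], [C,A]))], O2,
        [(1,Rot), (0,Slide), (0,Swap), (1,Swap), (2,Rot), (0,Slide), (1,Slide), (2,Rot)]))]"

fun core_types :: "bool \<Rightarrow> handles list" where
  "core_types False = [E1, E2]" | "core_types True = [O1, O2]"

fun K_types :: "bool \<Rightarrow> handles list" where
  "K_types False = [KE]" | "K_types True = [KO]"

fun G_types :: "bool \<Rightarrow> handles list" where
  "G_types False = [GE]" | "G_types True = [GO]"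

lemma core_table_ok: "list_all (entry_ok core_types) core_table" "covers core_types core_table"
    "list_all (\<lambda>(\<tau>, u\<^sub>1, u\<^sub>2, v, h). v = []) core_table"
  by code_simp+

lemma K_table_ok: "list_all (entry_ok core_types) K_table" "covers K_types K_table"
  by code_simp+

lemma KK_table_ok: "list_all (entry_ok K_types) KK_table"
  by code_simp

lemma G_table_ok: "list_all (entry_ok core_types) G_table" "covers G_types G_table"
  by code_simp+



section \<open>Contraction\<close>

fun sections :: "word \<Rightarrow> word \<times> word" where
  "sections [] = ([], [])"
| "sections (A # w) = (let (u, v) = sections w in (v, u))"
| "sections (B # w) = (let (u, v) = sections w in (A # u, C # v))"
| "sections (C # w) = (let (u, v) = sections w in (A # u, D # v))"
| "sections (D # w) = (let (u, v) = sections w in (u, B # v))"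

lemma sections: "sec0 (val w) = val (fst (sections w)) \<and> sec1 (val w) = val (snd (sections w))"
  by (induction w rule: sections.induct)
    (auto simp: sec0_plus sec1_plus gens_act gens_sec split: prod.splits)

text \<open>
  With these weights the sections of a letter other than \<open>a\<close> weigh one less than the letter together
  with an \<open>a\<close>, while a shortened word is lighter.
\<close>

fun lwt :: "letter \<Rightarrow> nat" where "lwt A = 3" | "lwt B = 5" | "lwt C = 4" | "lwt D = 3"

definition wt :: "word \<Rightarrow> nat" where "wt w = sum_list (map lwt w)"

definition numA :: "word \<Rightarrow> nat" where "numA w = length (filter (\<lambda>l. l = A) w)"
definition numV :: "word \<Rightarrow> nat" where "numV w = length (filter (\<lambda>l. l \<noteq> A) w)"

lemmas word_measures = wt_def numA_def numV_def

text \<open>Each a loses its weight 3, and the sections of any other letter weigh 2 more than the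
  letter.\<close>

lemma wt_sections:
  "wt (fst (sections w) @ snd (sections w)) + 3 * numA w = wt w + 2 * numV w"
  by (induction w rule: sections.induct) (auto simp: word_measures split: prod.splits)

lemma act_val: "act (val w) \<longleftrightarrow> \<not> even (numA w)"
proof (induction w)
  case (Cons l w) then show ?case by (cases l) (auto simp: act_plus gens_act numA_def)
qed (simp add: numA_def)

fun alternating :: "word \<Rightarrow> bool" where
  "alternating (l # m # w) \<longleftrightarrow> (l = A) \<noteq> (m = A) \<and> alternating (m # w)"
| "alternating _ \<longleftrightarrow> True"

lemma numV_alternating:
  "alternating w \<Longrightarrow> numV w \<le> numA w + (if w = [] \<or> hd w = A then 0 else 1)"
proof (induction w rule: alternating.induct)
  case (1 l m w) then show ?case by (cases "l = A"; cases "m = A") (auto simp: word_measures)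
qed (auto simp: word_measures)

lemma not_alternating:
  "\<not> alternating w \<Longrightarrow> \<exists>x l m y. w = x @ [l, m] @ y \<and> (l = A) = (m = A)"
proof (induction w rule: alternating.induct)
  case (1 l m w)
  show ?case
  proof (cases "(l = A) = (m = A)")
    case True
    then show ?thesis by (intro exI[of _ "[]"] exI[of _ l] exI[of _ m] exI[of _ w]) simp
  next
    case False
    then obtain x l' m' y where "m # w = x @ [l', m'] @ y" "(l' = A) = (m' = A)" using 1 by auto
    then show ?thesis by (intro exI[of _ "l # x"] exI[of _ l'] exI[of _ m'] exI[of _ y]) simp
  qed
qed auto

lemma shorten:
  assumes "(l = A) = (m = A)" shows "\<exists>w. val w = val [l, m] \<and> wt w < wt [l, m]"
proof -
  have "val [] = val [l, m] \<or> val [B] = val [l, m] \<and> lwt l + lwt m > 5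
      \<or> val [C] = val [l, m] \<and> lwt l + lwt m > 4 \<or> val [D] = val [l, m] \<and> lwt l + lwt m > 3"
    using assms by (cases l; cases m) (simp_all add: gens_simps)
  then show ?thesis
    by (elim disjE) (rule exI[of _ "[]"] exI[of _ "[B]"] exI[of _ "[C]"] exI[of _ "[D]"],
      cases l; simp add: wt_def)+
qed

text \<open>The words dabac and cabad have equal weight, and the first leads to the second; doubling
  the weight leaves room to break this tie.\<close>

definition word_rank :: "word \<Rightarrow> nat" where
  "word_rank w = 2 * wt w + (if w = [D,A,B,A,C] then 1 else 0)"

lemma word_rank_less: "wt u < wt w \<Longrightarrow> word_rank u < word_rank w"
proof -
  have "word_rank u \<le> 2 * wt u + 1" "2 * wt w \<le> word_rank w" by (simp_all add: word_rank_def)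
  then show "wt u < wt w \<Longrightarrow> word_rank u < word_rank w" by simp
qed

text \<open>
  The only words on which passing to the product of the states does not shorten are, up to
  shortening, \<open>cabad\<close> and \<open>dabac\<close>: they lead to \<open>acdab = abab\<close> and \<open>cabad\<close>.
\<close>

lemma K_word_induct [consumes 1, case_names zero step]:
  assumes "g \<in> K"
    and zero: "P 0"
    and step: "\<And>g. \<lbrakk>g \<in> K; sec0 g + sec1 g \<in> K \<Longrightarrow> P (sec0 g + sec1 g)\<rbrakk> \<Longrightarrow> P g"
  shows "P g"
proof -
  have "val w \<in> K \<Longrightarrow> P (val w)" for w
  proof (induction "word_rank w" arbitrary: w rule: less_induct)
    case less
    define u where "u = fst (sections w) @ snd (sections w)"
    have vu: "val u = sec0 (val w) + sec1 (val w)" by (simp add: u_def val_append sections)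
    have down: "P (val w)" if "val x = val u" "word_rank x < word_rank w" for x
      using step[OF less.prems] less.hyps[OF that(2)] that(1) vu by simp
    show ?case
    proof (cases "alternating w")
      case False
      then obtain x l m y where w: "w = x @ [l, m] @ y" "(l = A) = (m = A)"
        using not_alternating by blast
      obtain z where z: "val z = val [l, m]" "wt z < wt [l, m]" using shorten[OF w(2)] by blast
      have "val (x @ z @ y) = val w" using z(1) by (simp add: w(1) val_append add.assoc)
      moreover have "word_rank (x @ z @ y) < word_rank w"
        using z(2) by (intro word_rank_less) (simp add: w(1) wt_def)
      ultimately show ?thesis using less by metis
    next
      case alt: True
      have "\<not> act (val w)" using less.prems by (auto simp: K_iff class_K_def zero_Q_def)
      then have ev: "even (numA w)" by (simp add: act_val)
      have liftable: "numV w \<le> numA w + 1" using numV_alternating[OF alt] by (auto split: if_splits)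
      \<comment> \<open>By \<open>wt_sections\<close> the second case is the one where the states
        together are lighter than \<open>w\<close>. With \<open>numA w\<close> even and
        \<open>numV w\<close> at most one more, only lengths 0, 1 and 5 escape it.\<close>
      consider "w = []" | "2 * numV w < 3 * numA w" | "numA w = 0" "numV w = 1" | "numA w = 2" "numV w = 3"
      proof -
        have "numA w + numV w = length w" by (simp add: word_measures sum_length_filter_compl)
        moreover have "numA w = 0 \<or> numA w = 2 \<or> numA w \<ge> 3" using ev by presburger
        ultimately have "w = [] \<or> 2 * numV w < 3 * numA w \<or> (numA w = 0 \<and> numV w = 1) \<or> (numA w = 2 \<and> numV w = 3)"
          using liftable by (cases "numV w = 0") (auto simp: le_Suc_eq)
        then show thesis using that by blast
      qed
      then show ?thesis
      proof cases
        case 1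
        then show ?thesis using zero by simp
      next
        case 2
        then have "wt u < wt w" using wt_sections[of w] by (simp add: u_def)
        then show ?thesis by (intro down[of u] word_rank_less) simp_all
      next
        case 3
        then have "length w = 1" using sum_length_filter_compl[of "\<lambda>l. l = A" w] by (simp add: word_measures)
        then obtain l where "w = [l]" by (auto simp: length_Suc_conv)
        then have "wclass [l] = 0" using less.prems by (simp add: K_iff class_K_lval)
        then show ?thesis by (cases l) (auto simp: zero_Q_def)
      next
        case 4
        then have "length w = 5" using sum_length_filter_compl[of "\<lambda>l. l = A" w] by (simp add: word_measures)
        then obtain p q r s t where w: "w = [p, q, r, s, t]" by (auto simp: length_Suc_conv numeral_eq_Suc)
        have "p \<noteq> A \<and> q = A \<and> r \<noteq> A \<and> s = A \<and> t \<noteq> A"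
          using alt 4(1) unfolding w by (auto simp: numA_def split: if_splits)
        moreover have "wclass w = 0" using less.prems by (simp add: K_iff class_K_val)
        ultimately have "w = [C,A,B,A,D] \<or> w = [D,A,B,A,C]"
          unfolding w by (cases p; cases r; cases t) (simp_all add: zero_Q_def)
        then show ?thesis
        proof
          assume "w = [C,A,B,A,D]"
          then show ?thesis
            by (intro down[of "[A,B,A,B]"]) (simp_all add: u_def gens_simps word_rank_def wt_def add.assoc)
        next
          assume "w = [D,A,B,A,C]"
          then show ?thesis
            by (intro down[of "[C,A,B,A,D]"]) (simp_all add: u_def word_rank_def wt_def add.assoc)
        qed
      qed
    qed
  qed
  then show ?thesis using G_val assms(1) K_sub_G by blast
qed

section \<open>Products of two commutators\<close>

lemma zero_solvable: "solvable core_types 0"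
proof -
  have "0 \<in> constrained (hclass E1)" by (rule constrained_extends[of "[]"]) (simp_all add: E1_def hclass_def zero_Q_def)
  \<comment> \<open>The classes d, b form the only handle of \<open>E2\<close> that is not trivial;
    it is filled by [d, b] = 1.\<close>
  moreover have "comm gD gB + 0 \<in> constrained [(wclass [D], wclass [B])]"
    by (intro constrained_ConsI) (simp_all add: class_K_gens zero_Q_def)
  then have "0 \<in> constrained [(wclass [D], wclass [B])]" by (simp add: comm_def gens_simps)
  then have "0 \<in> constrained (hclass E2)"
    by (rule constrained_extends[rotated]) (simp_all add: E2_def hclass_def zero_Q_def)
  ultimately show ?thesis by (simp add: solvable_def odd_class_def)
qed

text \<open>All entries of the core table have \<open>v = []\<close>, so the reduced right-hand side
  is exactly the product of the states on which \<open>K_word_induct\<close> descends.\<close>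

theorem core_solvable: "g \<in> K \<Longrightarrow> solvable core_types g"
proof (induction g rule: K_word_induct)
  case zero
  show ?case by (rule zero_solvable)
next
  case (step g)
  show ?case
    unfolding solvable_def
  proof
    fix \<tau> assume \<tau>: "\<tau> \<in> set (core_types (odd_class g))"
    obtain g\<^sub>1 g\<^sub>2 u\<^sub>1 u\<^sub>2 where *: "g = N False g\<^sub>1 g\<^sub>2" "g\<^sub>1 \<in> G" "g\<^sub>2 \<in> G" "class_K g\<^sub>1 = wclass u\<^sub>1" "class_K g\<^sub>2 = wclass u\<^sub>2"
      "(odd_class g, u\<^sub>1, u\<^sub>2) \<in> set K_states" using K_cases[OF step(1)] .
    then obtain v h\<^sub>0 h\<^sub>1 where e: "(\<tau>, u\<^sub>1, u\<^sub>2, v, h\<^sub>0, h\<^sub>1) \<in> set core_table"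
      using core_table_ok(2) \<tau> unfolding covers_def by fastforce
    then have "entry_ok core_types (\<tau>, u\<^sub>1, u\<^sub>2, v, h\<^sub>0, h\<^sub>1)" "v = []"
      using core_table_ok(1,3) unfolding list_all_iff by fastforce+
    then show "g \<in> constrained (hclass \<tau>)"
      unfolding *(1) using * step(2) by (intro entry_sound[where S = core_types and v = v]) simp_all
  qed
qed

theorem K_solvable: "g \<in> K \<Longrightarrow> solvable K_types g"
  by (rule solvable_by_table[OF K_table_ok core_solvable])

theorem KK_solvable:
  assumes "g\<^sub>1 \<in> K" "g\<^sub>2 \<in> K" shows "N False g\<^sub>1 g\<^sub>2 \<in> constrained (hclass KK)"
proof -
  obtain v h\<^sub>0 h\<^sub>1 where e: "KK_table = [(KK, [], [], v, h\<^sub>0, h\<^sub>1)]" by (simp add: KK_table_def)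
  have "entry_ok K_types (KK, [], [], v, h\<^sub>0, h\<^sub>1)" using KK_table_ok unfolding e by (simp del: entry_ok.simps)
  then show ?thesis by (rule entry_sound) (use assms K_solvable in \<open>simp_all add: K_iff\<close>)
qed

text \<open>An element with states in the cosets of ca and ac lies in K, so the equation over K
  splits into one of type \<open>KK\<close> for each state. The second is the conjugate by a of a
  \<open>KK\<close> equation, which exchanges \<open>u\<close> and \<open>v\<close>.\<close>

theorem K4_two_commutators:
  assumes "x \<in> K" "y \<in> K" "u \<in> K" "v \<in> K"
  shows "N False (N False x y) (N False u v) \<in> constrained [(0, 0), (0, 0)]"
proof -
  let ?L = "[((wclass [C,A], wclass [A,C]), (0, 0)), ((0, 0), (0, 0))]"
  have "N False x y \<in> constrained (map quad_fst ?L)"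
    using KK_solvable[OF assms(1,2)] by (simp add: KK_def hclass_def)
  moreover have "N False u v \<in> constrained (map quad_snd ?L)"
    using constrained_conj[OF KK_solvable[OF assms(4,3)], of gA] unfolding N_conj_gA
    by (simp add: KK_def hclass_def conjp_def class_K_gens zero_Q_def minus_Q_def)
  ultimately have "N False (N False x y) (N False u v) \<in> constrained (map quad_up ?L)"
    by (rule constrained_quads) (simp add: zero_Q_def)
  then show ?thesis by (simp add: zero_Q_def)
qed

text \<open>The derived subgroup of \<open>G\<close> is \<open>K \<union> (ad)\<^sup>2K\<close>; for the coset \<open>(ad)\<^sup>2K\<close> the states lie in \<open>b(ca)\<^sup>mK\<close> and \<open>b(ac)\<^sup>mK\<close>.\<close>

theorem G_two_commutators:
  assumes "g \<in> G" "class_K g = 0 \<or> class_K g = wclass [A,D,A,D]"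
  shows "\<exists>p q p' q'. g \<in> constrained [(p, q), (p', q')]"
  using assms(2)
proof
  assume "class_K g = 0"
  then have "solvable G_types g" using assms(1) by (intro solvable_by_table[OF G_table_ok core_solvable]) (simp_all add: K_iff)
  then show ?thesis by (cases "odd_class g") (auto simp: solvable_def GE_def GO_def hclass_def)
next
  assume q: "class_K g = wclass [A,D,A,D]"
  then obtain s g\<^sub>1 g\<^sub>2 where g: "g = N s g\<^sub>1 g\<^sub>2" "g\<^sub>1 \<in> G" "g\<^sub>2 \<in> G" "liftable (class_K g\<^sub>1) (class_K g\<^sub>2)" "lift_class s (class_K g\<^sub>1) (class_K g\<^sub>2) = wclass [A,D,A,D]"
    using G_cases[OF assms(1)] by metis
  obtain t k\<^sub>1 k\<^sub>2 e where q1: "class_K g\<^sub>1 = Q t k\<^sub>1 k\<^sub>2 e" by (cases "class_K g\<^sub>1")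
  obtain u m\<^sub>1 m\<^sub>2 f where q2: "class_K g\<^sub>2 = Q u m\<^sub>1 m\<^sub>2 f" by (cases "class_K g\<^sub>2")
  have s: "\<not> s" using g(5) by (simp add: q1 q2 zero_Q_def)
  have "\<exists>(\<tau>, u\<^sub>1, u\<^sub>2, e)\<in>set G_table. length \<tau> = 2 \<and> class_K g\<^sub>1 = wclass u\<^sub>1 \<and> class_K g\<^sub>2 = wclass u\<^sub>2"
    using g(4,5) unfolding q1 q2 G_table_def GE_def GO_def Z1_def Z3_def
    by (cases t; cases k\<^sub>1; cases k\<^sub>2) (auto simp: zero_Q_def)
  then obtain \<tau> u\<^sub>1 u\<^sub>2 v h\<^sub>0 h\<^sub>1 where e: "(\<tau>, u\<^sub>1, u\<^sub>2, v, h\<^sub>0, h\<^sub>1) \<in> set G_table" "length \<tau> = 2"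
    "class_K g\<^sub>1 = wclass u\<^sub>1" "class_K g\<^sub>2 = wclass u\<^sub>2" by fastforce
  then have "entry_ok core_types (\<tau>, u\<^sub>1, u\<^sub>2, v, h\<^sub>0, h\<^sub>1)" using G_table_ok(1) unfolding list_all_iff by blast
  then have "N False g\<^sub>1 g\<^sub>2 \<in> constrained (hclass \<tau>)"
    by (rule entry_sound) (use g e core_solvable in simp_all)
  moreover obtain h h' where "\<tau> = [h, h']" using e(2) by (auto simp: length_Suc_conv numeral_eq_Suc)
  ultimately show ?thesis using g(1) s by (cases h; cases h') (auto simp: hclass_def)
qed



section \<open>A finite quotient\<close>

datatype leaf = Leaf bool bool

instantiation leaf :: group_add
begin

definition zero_leaf :: leaf where "0 = Leaf False False"
fun plus_leaf :: "leaf \<Rightarrow> leaf \<Rightarrow> leaf" where "Leaf a b + Leaf c d = Leaf (a \<noteq> c) (b \<noteq> d)"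
definition uminus_leaf :: "leaf \<Rightarrow> leaf" where "- x = (x :: leaf)"
definition minus_leaf :: "leaf \<Rightarrow> leaf \<Rightarrow> leaf" where "x - y = x + - (y :: leaf)"

instance
proof
  fix x y z :: leaf
  show "x + y + z = x + (y + z)" "0 + x = x" "x + 0 = x" "- x + x = 0" "x + - y = x - y"
    by (cases x; cases y; cases z; auto simp: zero_leaf_def uminus_leaf_def minus_leaf_def)+
qed

end

datatype 'a wr = Wr bool 'a 'a

instantiation wr :: (group_add) group_add
begin

definition zero_wr :: "'a wr" where "0 = Wr False 0 0"

fun plus_wr :: "'a wr \<Rightarrow> 'a wr \<Rightarrow> 'a wr" where
  "Wr s x y + Wr t u v = Wr (s \<noteq> t) (x + (if s then v else u)) (y + (if s then u else v))"

fun uminus_wr :: "'a wr \<Rightarrow> 'a wr" where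
  "- Wr s x y = Wr s (if s then - y else - x) (if s then - x else - y)"

definition minus_wr :: "'a wr \<Rightarrow> 'a wr \<Rightarrow> 'a wr" where "x - y = x + - (y :: 'a wr)"

instance
proof
  fix x y z :: "'a wr"
  show "x + y + z = x + (y + z)" by (cases x; cases y; cases z) (auto simp: add.assoc)
  show "0 + x = x" "x + 0 = x" "- x + x = 0" "x + - y = x - y"
    by (cases x; auto simp: zero_wr_def minus_wr_def)+
qed

end

text \<open>
  On \<open>G\<close> the kernel \<open>N\<close> of the homomorphism \<open>nu\<close> is contained in \<open>K\<close>; the image of \<open>G\<close> has order
  256, and \<open>[K, G]/N\<close> is elementary abelian of order 8.
\<close>

type_synonym nu = "leaf wr wr"

definition nu1 :: "aut \<Rightarrow> leaf wr" where
  "nu1 x = Wr (act x) (Leaf (act (sec0 x)) (parity2 (sec0 x))) (Leaf (act (sec1 x)) (parity2 (sec1 x)))"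

definition nu :: "aut \<Rightarrow> nu" where "nu x = Wr (act x) (nu1 (sec0 x)) (nu1 (sec1 x))"

lemma nu_plus: "nu (x + y) = nu x + nu y"
  by (auto simp: nu_def nu1_def act_plus sec0_plus sec1_plus parity2_plus)

lemma nu_0: "nu 0 = 0"
  using nu_plus[of 0 0] by (simp add: nu_def nu1_def zero_wr_def zero_leaf_def parity12_0)

lemma nu_uminus: "nu (- x) = - nu x"
  by (rule minus_unique[symmetric]) (simp add: nu_plus[symmetric] nu_0)

lemma nu_diff: "nu (x - y) = nu x - nu y"
  by (simp only: diff_conv_add_uminus nu_plus nu_uminus)

lemma nu_comm: "nu (comm x y) = comm (nu x) (nu y)"
  by (simp add: comm_def nu_plus nu_diff)

fun nl :: "letter \<Rightarrow> nu" where
  "nl A = Wr True 0 0"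
| "nl B = Wr False (Wr True 0 0) (Wr False (Leaf True False) (Leaf False True))"
| "nl C = Wr False (Wr True 0 0) (Wr False 0 (Leaf False True))"
| "nl D = Wr False 0 (Wr False (Leaf True False) (Leaf False False))"

fun nw :: "word \<Rightarrow> nu" where "nw [] = 0" | "nw (l # w) = nl l + nw w"

lemma nu_lval: "nu (lval l) = nl l"
  by (cases l) (simp_all add: nu_def nu1_def gens_act gens_sec gens_s parity12_0 zero_wr_def zero_leaf_def)

lemma nu_val: "nu (val w) = nw w"
  by (induction w) (simp_all add: nu_0 nu_plus nu_lval)

fun rep_word :: "Q \<Rightarrow> word" where
  "rep_word (Q s k\<^sub>1 k\<^sub>2 e) = (if e then [B] else []) @ (if k\<^sub>1 then [A,D,A] else []) @ (if k\<^sub>2 then [D] else []) @ (if s then [A] else [])"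

lemma val_rep_word: "val (rep_word q) = rep q"
  by (cases q) (auto simp: val_append add.assoc)

text \<open>The values of \<open>nu\<close> at \<open>t = (ab)\<^sup>2\<close>, \<open>t\<^sup>2\<close>, \<open>(bada)\<^sup>2\<close> and \<open>(abad)\<^sup>2\<close>.\<close>

definition nt :: nu where
  "nt = Wr False (Wr True (Leaf True False) (Leaf False True)) (Wr True (Leaf False True) (Leaf True False))"
definition nx :: nu where
  "nx = Wr False (Wr False (Leaf True True) (Leaf True True)) (Wr False (Leaf True True) (Leaf True True))"
definition ny :: nu where "ny = Wr False (Wr False (Leaf True False) (Leaf True False)) 0"
definition nz :: nu where "nz = Wr False 0 (Wr False (Leaf True False) (Leaf True False))"

definition KL :: "nu list" where
  "KL = concat (map (\<lambda>x. map (\<lambda>y. x + y) [0, ny, nz, ny + nz]) [0, nt, nx, nx + nt])"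

definition allQ :: "Q list" where
  "allQ = concat (map (\<lambda>s. concat (map (\<lambda>k\<^sub>1. concat (map (\<lambda>k\<^sub>2. map (Q s k\<^sub>1 k\<^sub>2) [False, True]) [False, True])) [False, True])) [False, True])"

lemma in_allQ: "q \<in> set allQ"
proof -
  obtain s k\<^sub>1 k\<^sub>2 e where "q = Q s k\<^sub>1 k\<^sub>2 e" by (cases q)
  then show ?thesis by (cases s; cases k\<^sub>1; cases k\<^sub>2; cases e; simp add: allQ_def)
qed

text \<open>Up to the value of \<open>dact\<close>, this is \<open>nu\<close> of [t, x] for x of the
  given class. \<open>dact\<close> is the contribution of [k, x] with k in [K, G]: x acts there only
  by exchanging \<open>ny\<close> and \<open>nz\<close>, namely when it swaps the subtrees.\<close>

fun dvec :: "Q \<Rightarrow> nu" where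
  "dvec (Q s k\<^sub>1 k\<^sub>2 e) = (if s \<noteq> e then nx else 0) +
     (if s then (if k\<^sub>1 \<noteq> k\<^sub>2 then ny else 0) else (if k\<^sub>1 then ny else 0) + (if k\<^sub>2 then nz else 0))"

fun dact :: "Q \<Rightarrow> nu" where "dact (Q s k\<^sub>1 k\<^sub>2 e) = (if s then ny + nz else 0)"

text \<open>\<open>span1 (class_K x)\<close> contains the values of \<open>nu\<close> at the commutators \<open>[k, x]\<close> with \<open>k \<in> K\<close>.\<close>

definition span1 :: "Q \<Rightarrow> nu list" where
  "span1 p = [0, dvec p, dact p, dvec p + dact p]"

text \<open>The ambiguity of \<open>nu\<close> at [x, y] when x and y vary in their cosets. A single
  generator \<open>c\<close> stands for both \<open>dact\<close> values, which are 0 or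
  \<open>ny + nz\<close>.\<close>

definition span2 :: "Q \<Rightarrow> Q \<Rightarrow> nu list" where
  "span2 p q = (let c = (if dact p = 0 then dact q else dact p) in
     [0, dvec p, dvec q, dvec p + dvec q, c, dvec p + c, dvec q + c, dvec p + dvec q + c])"

lemma KL_checks:
  "list_all (\<lambda>x. list_all (\<lambda>y. x + y \<in> set KL \<and> comm x y = 0) KL) KL"
  "list_all (\<lambda>l. list_all (\<lambda>x. nl l + x - nl l \<in> set KL) KL) [A,B,C,D]"
  "list_all (\<lambda>q. list_all (\<lambda>x. comm x (nw (rep_word q)) \<in> set (span1 q)) KL) allQ"
  "list_all (\<lambda>q. list_all (\<lambda>x. x \<in> set KL \<and> x + x = 0) (span1 q)) allQ"
  "nt \<in> set KL" "0 \<in> set KL" "nw [A,B,A,B] = nt"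
  by code_simp+

lemma span2_checks:
  "list_all (\<lambda>p. list_all (\<lambda>q. list_all (\<lambda>x. x \<in> set (span2 p q)) (span1 p @ span1 (comm p q) @ span1 (comm p q + q))) allQ) allQ"
  "list_all (\<lambda>p. list_all (\<lambda>q. list_all (\<lambda>x. list_all (\<lambda>y. x + y = y + x \<and> x + x = 0) [dvec p, dvec q, dact p, dact q]) [dvec p, dvec q, dact p, dact q]) allQ) allQ"
  by code_simp+



lemma nu_K: "k \<in> K \<Longrightarrow> nu k \<in> set KL"
proof (induction rule: K.induct)
  case (K_step k g)
  have *: "nu (g + x - g) \<in> set KL" if "g \<in> G" "nu x \<in> set KL" for g x
    using that
  proof (induction g arbitrary: x rule: G.induct)
    case (G_step g h)
    obtain l where h: "h = lval l" using G_step.hyps(2) by (metis empty_iff insert_iff lval.simps)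
    have "nu (h + x - h) \<in> set KL"
      using KL_checks(2) G_step.prems unfolding list_all_iff
      by (cases l) (simp_all add: h nu_plus nu_diff nu_lval[symmetric] del: nl.simps lval.simps)
    then have "nu (g + (h + x - h) - g) \<in> set KL" by (rule G_step.IH)
    moreover have "g + (h + x - h) - g = (g + h) + x - (g + h)" by (simp only: free_group)
    ultimately show ?case by simp
  qed simp
  have "t_elt = val [A,B,A,B]" by (simp add: t_elt_def add.assoc)
  then have "nu t_elt = nt" using nu_val[of "[A,B,A,B]"] KL_checks(7) by metis
  then have "nu (g + t_elt - g) \<in> set KL" using *[OF K_step.hyps(2), of t_elt] KL_checks(5) by simp
  then show ?case using K_step.IH KL_checks(1) unfolding list_all_iff nu_plus by blast
qed (simp add: nu_0 KL_checks(6))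

lemma KL_commute: "\<lbrakk>x \<in> set KL; y \<in> set KL\<rbrakk> \<Longrightarrow> x + y = y + x"
proof -
  assume "x \<in> set KL" "y \<in> set KL"
  then have "comm x y = 0" using KL_checks(1) unfolding list_all_iff by blast
  then have "x + y - x = y" by (simp add: comm_def)
  then show "x + y = y + x" by (simp add: diff_eq_eq)
qed

lemma span1_KL: "e \<in> set (span1 q) \<Longrightarrow> e \<in> set KL \<and> e + e = 0"
  using KL_checks(4) in_allQ unfolding list_all_iff by blast

lemma nu_cm_K:
  assumes k: "k \<in> K" and x: "x \<in> G" shows "nu (comm k x) \<in> set (span1 (class_K x))"
proof -
  define l where "l = x - rep (class_K x)"
  have l: "l \<in> K" "x = l + rep (class_K x)" using G_rep[OF x] by (simp_all add: l_def)
  have "comm k x = comm k l + (l + comm k (rep (class_K x)) - l)"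
    unfolding l(2)[symmetric] by (subst l(2)) (simp only: comm_def free_group)
  then have "nu (comm k x) = comm (nu k) (nu l) + (nu l + comm (nu k) (nw (rep_word (class_K x))) - nu l)"
    by (simp only: nu_plus nu_diff nu_comm nu_val[symmetric] val_rep_word)
  moreover have "comm (nu k) (nu l) = 0" using KL_checks(1) nu_K[OF k] nu_K[OF l(1)] unfolding list_all_iff by blast
  moreover have e: "comm (nu k) (nw (rep_word (class_K x))) \<in> set (span1 (class_K x))"
    using KL_checks(3) in_allQ nu_K[OF k] unfolding list_all_iff by blast
  moreover have "nu l + comm (nu k) (nw (rep_word (class_K x))) - nu l = comm (nu k) (nw (rep_word (class_K x)))"
    using KL_commute[OF nu_K[OF l(1)] span1_KL[OF e, THEN conjunct1]] by simp
  ultimately show ?thesis by simp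
qed

lemma span1_sub_sp:
  "set (span1 p) \<subseteq> set (span2 p q)" "set (span1 (comm p q)) \<subseteq> set (span2 p q)" "set (span1 (comm p q + q)) \<subseteq> set (span2 p q)"
  using span2_checks(1) in_allQ unfolding list_all_iff by fastforce+

lemma span2_closed:
  assumes "x \<in> set (span2 p q)" "y \<in> set (span2 p q)" shows "x + y \<in> set (span2 p q)"
proof -
  define a b c where "a = dvec p" and "b = dvec q" and "c = (if dact p = 0 then dact q else dact p)"
  have *: "u + v = v + u" "u + u = 0" if "u \<in> {a, b, c}" "v \<in> {a, b, c}" for u v
    using span2_checks(2) in_allQ[of p] in_allQ[of q] that unfolding list_all_iff a_def b_def c_def
    by (auto split: if_splits)
  have comm: "b + a = a + b" "c + a = a + c" "c + b = b + c" using * by blast+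
  have sq: "a + a = 0" "b + b = 0" "c + c = 0" using *[of _ a] by blast+
  have left: "b + (a + z) = a + (b + z)" "c + (a + z) = a + (c + z)" "c + (b + z) = b + (c + z)"
    "a + (a + z) = z" "b + (b + z) = z" "c + (c + z) = z" for z
    by (simp_all only: add.assoc[symmetric] comm sq add_0_left)
  have span2: "span2 p q = [0, a, b, a + b, c, a + c, b + c, a + b + c]"
    by (simp add: span2_def a_def b_def c_def Let_def)
  show ?thesis
    using assms unfolding span2 by (auto simp: add.assoc comm left sq)
qed

definition possible :: "nu \<Rightarrow> Q \<Rightarrow> Q \<Rightarrow> bool" where
  "possible n p q \<longleftrightarrow> (let c = comm (nw (rep_word p)) (nw (rep_word q)) in list_ex (\<lambda>e. n = e + c) (span2 p q))"

lemma possible_sound: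
  assumes "x \<in> G" "y \<in> G" shows "possible (nu (comm x y)) (class_K x) (class_K y)"
proof -
  let ?S = "set (span2 (class_K x) (class_K y))"
  define r s where "r = rep (class_K x)" and "s = rep (class_K y)"
  define k l where "k = x - r" and "l = y - s"
  have k: "k \<in> K" "l \<in> K" using assms G_rep by (simp_all add: k_def l_def r_def s_def)
  have xy: "x = k + r" "y = l + s" by (simp_all add: k_def l_def)
  have rs: "r \<in> G" "class_K r = class_K x" "s \<in> G" "class_K s = class_K y" by (simp_all add: r_def s_def)
  \<comment> \<open>Except for the last, each factor has an entry in K, so its value lies in the
    span; the last depends only on the classes.\<close>
  have "comm x y = comm k (comm r y + y) + (comm r l + (comm l (comm r s) + comm r s))"
    unfolding xy by (simp only: comm_def free_group)
  moreover have "nu (comm k (comm r y + y)) \<in> ?S"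
    using nu_cm_K[OF k(1), of "comm r y + y"] rs assms span1_sub_sp(3) by (auto simp: class_K_plus class_K_comm)
  moreover have "nu (comm l (comm r s)) \<in> ?S"
    using nu_cm_K[OF k(2), of "comm r s"] rs span1_sub_sp(2) by (auto simp: class_K_comm)
  moreover have "nu (comm r l) \<in> ?S"
  proof -
    have e: "nu (comm l r) \<in> set (span1 (class_K x))" using nu_cm_K[OF k(2) rs(1)] rs by simp
    have "comm r l = - comm l r" by (simp only: comm_def free_group)
    then have "nu (comm r l) = nu (comm l r)"
      using span1_KL[OF e] by (simp add: nu_uminus minus_unique)
    then show ?thesis using e span1_sub_sp(1) by auto
  qed
  moreover have "nu (comm r s) = comm (nw (rep_word (class_K x))) (nw (rep_word (class_K y)))"
    by (simp only: nu_comm nu_val[symmetric] val_rep_word r_def s_def)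
  ultimately obtain e f g where "{e, f, g} \<subseteq> ?S"
    "nu (comm x y) = e + (f + (g + comm (nw (rep_word (class_K x))) (nw (rep_word (class_K y)))))"
    by (simp add: nu_plus)
  then have "e + f + g \<in> ?S" "nu (comm x y) = (e + f + g) + comm (nw (rep_word (class_K x))) (nw (rep_word (class_K y)))"
    using span2_closed by (auto simp: add.assoc)
  then show ?thesis unfolding possible_def Let_def list_ex_iff by blast
qed

section \<open>Elements that are not commutators\<close>

text \<open>\<open>cyclic_pair p q\<close>: the images of \<open>p\<close> and \<open>q\<close> in the dihedral group \<open>\<langle>a, d\<rangle>\<close> of order 8 generate a cyclic group.\<close>

fun rotation :: "Q \<Rightarrow> bool" where "rotation (Q s k\<^sub>1 k\<^sub>2 e) \<longleftrightarrow> s = (k\<^sub>1 \<noteq> k\<^sub>2)"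

fun cyclic_pair :: "Q \<Rightarrow> Q \<Rightarrow> bool" where
  "cyclic_pair (Q s k\<^sub>1 k\<^sub>2 e) (Q t m\<^sub>1 m\<^sub>2 f) \<longleftrightarrow>
     \<not> s \<and> \<not> k\<^sub>1 \<and> \<not> k\<^sub>2 \<or> \<not> t \<and> \<not> m\<^sub>1 \<and> \<not> m\<^sub>2 \<or> s = t \<and> k\<^sub>1 = m\<^sub>1 \<and> k\<^sub>2 = m\<^sub>2 \<or> s = (k\<^sub>1 \<noteq> k\<^sub>2) \<and> t = (m\<^sub>1 \<noteq> m\<^sub>2)"

definition liftable_pairs :: "(Q \<times> Q) list" where
  "liftable_pairs = concat (map (\<lambda>p. filter (\<lambda>(p, q). liftable p q) (map (Pair p) allQ)) allQ)"

lemma in_liftable_pairs: "liftable p q \<Longrightarrow> (p, q) \<in> set liftable_pairs"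
  using in_allQ by (auto simp: liftable_pairs_def)

lemma cyclic_pair_checks:
  "list_all (\<lambda>p. list_all (\<lambda>q. cyclic_pair p (q + p) = cyclic_pair p q \<and> cyclic_pair (p + q - p) (- p) = cyclic_pair p q \<and> (rotation p \<and> rotation q \<longrightarrow> cyclic_pair p q)
     \<and> (rotation q = rotation (p + q - p))) allQ) allQ"
  "list_all (\<lambda>(p, p'). list_all (\<lambda>(q, q'). cyclic_pair p q = cyclic_pair p' q' \<and>
      (q = p + q' - p \<longrightarrow> rotation (p' + p) \<and> rotation q')) liftable_pairs) liftable_pairs"
  by code_simp+

text \<open>Nested conditionals instead of conjunctions, since \<open>code_simp\<close> evaluates all conjuncts.\<close>

definition excludes :: "bool \<Rightarrow> word \<Rightarrow> word \<Rightarrow> bool" where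
  "excludes c w w' \<longleftrightarrow> (let n = nw w; n' = nw w'; z = wclass w; z' = wclass w'; ks = KL in
     list_all (\<lambda>(p, p'). list_all (\<lambda>(q, q').
       (if comm p q = z then if comm p' q' = z' then if cyclic_pair (lift_class False p p') (lift_class False q q') = c then
          if possible n p q then \<not> possible n' p' q' else True else True else True else True) \<and>
       (if q = - z + p + q' - p then if cyclic_pair (lift_class True p p') (lift_class False q q') = c then
          list_all (\<lambda>k. let h = k + nw (rep_word p') in \<not> possible (h + n - h + n') (p' + p) q') ks
          else True else True)) liftable_pairs) liftable_pairs)"

lemma excludes_elA: "excludes True [A,D,A,D] [A,C,A,B,A,B,A,C]"
  by code_simp

lemma excludes_elB: "excludes False [A,B,A,B,A,B,A,B] [A,C,A,C,A,C,A,C]"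
  by code_simp



text \<open>The two Nielsen moves in the hypotheses keep the commutator. If both entries are active,
  the first move makes the second entry inactive; if only the second is, the other move exchanges
  the roles. \<open>P\<close> is any property of the classes carried along.\<close>

lemma commutator_inactive:
  assumes "p \<in> G" "q \<in> G"
    and P: "\<And>p q. P p q \<Longrightarrow> P p (q + p)" "\<And>p q. P p q \<Longrightarrow> P (p + q - p) (- p)" "P (class_K p) (class_K q)"
  obtains p' q' where "p' \<in> G" "q' \<in> G" "comm p' q' = comm p q" "\<not> act q'" "P (class_K p') (class_K q')"
proof -
  consider "\<not> act q" | "act q" "act p" | "act q" "\<not> act p" by blast
  then show thesis
  proof cases
    case 1
    then show ?thesis using that[of p q] assms by simp
  next
    case 2
    have "comm p (q + p) = comm p q" by (simp only: comm_def free_group)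
    then show ?thesis using that[of p "q + p"] assms 2 by (simp add: act_plus class_K_plus)
  next
    case 3
    have "comm (p + q - p) (- p) = comm p q" by (simp only: comm_def free_group)
    then show ?thesis using that[of "p + q - p" "- p"] assms 3 by (simp add: act_uminus class_K_plus class_K_diff class_K_uminus)
  qed
qed

lemma commutator_states:
  assumes "p \<in> G" "q \<in> G" "comm p q = N False g\<^sub>1 g\<^sub>2" "\<not> act q"
  obtains (inactive) p\<^sub>1 p\<^sub>2 q\<^sub>1 q\<^sub>2 where "{p\<^sub>1, p\<^sub>2, q\<^sub>1, q\<^sub>2} \<subseteq> G" "liftable (class_K p\<^sub>1) (class_K p\<^sub>2)" "liftable (class_K q\<^sub>1) (class_K q\<^sub>2)"
      "class_K p = lift_class False (class_K p\<^sub>1) (class_K p\<^sub>2)" "class_K q = lift_class False (class_K q\<^sub>1) (class_K q\<^sub>2)"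
      "comm p\<^sub>1 q\<^sub>1 = g\<^sub>1" "comm p\<^sub>2 q\<^sub>2 = g\<^sub>2"
  | (active) p\<^sub>1 p\<^sub>2 q\<^sub>1 q\<^sub>2 where "{p\<^sub>1, p\<^sub>2, q\<^sub>1, q\<^sub>2} \<subseteq> G" "liftable (class_K p\<^sub>1) (class_K p\<^sub>2)" "liftable (class_K q\<^sub>1) (class_K q\<^sub>2)"
      "class_K p = lift_class True (class_K p\<^sub>1) (class_K p\<^sub>2)" "class_K q = lift_class False (class_K q\<^sub>1) (class_K q\<^sub>2)"
      "class_K q\<^sub>1 = - class_K g\<^sub>1 + class_K p\<^sub>1 + class_K q\<^sub>2 - class_K p\<^sub>1" "comm (p\<^sub>2 + p\<^sub>1) q\<^sub>2 = p\<^sub>2 + g\<^sub>1 - p\<^sub>2 + g\<^sub>2"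
proof -
  obtain s p\<^sub>1 p\<^sub>2 where p: "p = N s p\<^sub>1 p\<^sub>2" "p\<^sub>1 \<in> G" "p\<^sub>2 \<in> G" "liftable (class_K p\<^sub>1) (class_K p\<^sub>2)" "class_K p = lift_class s (class_K p\<^sub>1) (class_K p\<^sub>2)"
    using G_cases[OF assms(1)] .
  obtain t q\<^sub>1 q\<^sub>2 where q: "q = N t q\<^sub>1 q\<^sub>2" "q\<^sub>1 \<in> G" "q\<^sub>2 \<in> G" "liftable (class_K q\<^sub>1) (class_K q\<^sub>2)" "class_K q = lift_class t (class_K q\<^sub>1) (class_K q\<^sub>2)"
    using G_cases[OF assms(2)] .
  have t: "t = False" using assms(4) q(1) by simp
  show thesis
  proof (cases s)
    case False
    then show ?thesis using p q t assms(3) by (intro inactive[of p\<^sub>1 p\<^sub>2 q\<^sub>1 q\<^sub>2]) (auto simp: comm_N_inactive)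
  next
    case True
    then have "N False (p\<^sub>1 + q\<^sub>2 - p\<^sub>1 - q\<^sub>1) (p\<^sub>2 + q\<^sub>1 - p\<^sub>2 - q\<^sub>2) = N False g\<^sub>1 g\<^sub>2"
      using assms(3) unfolding p(1) q(1) comm_def diff_conv_add_uminus t by (simp add: N_plus N_uminus del: add_uminus_conv_diff)
    then have g: "g\<^sub>1 = p\<^sub>1 + q\<^sub>2 - p\<^sub>1 - q\<^sub>1" "g\<^sub>2 = p\<^sub>2 + q\<^sub>1 - p\<^sub>2 - q\<^sub>2" by auto
    have "q\<^sub>1 = - g\<^sub>1 + p\<^sub>1 + q\<^sub>2 - p\<^sub>1" unfolding g by (simp only: free_group)
    then have "class_K q\<^sub>1 = - class_K g\<^sub>1 + class_K p\<^sub>1 + class_K q\<^sub>2 - class_K p\<^sub>1" by (metis class_K_plus class_K_uminus class_K_diff)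
    moreover have "comm (p\<^sub>2 + p\<^sub>1) q\<^sub>2 = p\<^sub>2 + g\<^sub>1 - p\<^sub>2 + g\<^sub>2" unfolding g comm_def by (simp only: free_group)
    ultimately show ?thesis using True p q t by (intro active[of p\<^sub>1 p\<^sub>2 q\<^sub>1 q\<^sub>2]) auto
  qed
qed

lemma check_sound:
  assumes c: "excludes c w w'" and p: "p \<in> G" "q \<in> G" "comm p q = N False g\<^sub>1 g\<^sub>2"
    and n: "nu g\<^sub>1 = nw w" "nu g\<^sub>2 = nw w'" "class_K g\<^sub>1 = wclass w" "class_K g\<^sub>2 = wclass w'"
  shows "cyclic_pair (class_K p) (class_K q) \<noteq> c"
proof
  assume cyclic_pair: "cyclic_pair (class_K p) (class_K q) = c"
  note c' = c[unfolded excludes_def Let_def list_all_iff]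
  have chk: "\<not> (possible (nw w) (class_K p\<^sub>1) (class_K q\<^sub>1) \<and> possible (nw w') (class_K p\<^sub>2) (class_K q\<^sub>2))"
    if "liftable (class_K p\<^sub>1) (class_K p\<^sub>2)" "liftable (class_K q\<^sub>1) (class_K q\<^sub>2)" "cyclic_pair (lift_class False (class_K p\<^sub>1) (class_K p\<^sub>2)) (lift_class False (class_K q\<^sub>1) (class_K q\<^sub>2)) = c"
      "comm (class_K p\<^sub>1) (class_K q\<^sub>1) = wclass w" "comm (class_K p\<^sub>2) (class_K q\<^sub>2) = wclass w'" for p\<^sub>1 p\<^sub>2 q\<^sub>1 q\<^sub>2
    using bspec[OF bspec[OF c' in_liftable_pairs[OF that(1)], unfolded prod.case] in_liftable_pairs[OF that(2)], unfolded prod.case] that(3-)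
    by simp
  have chk': "\<not> possible (k + nw (rep_word (class_K p\<^sub>2)) + nw w - (k + nw (rep_word (class_K p\<^sub>2))) + nw w') (class_K p\<^sub>2 + class_K p\<^sub>1) (class_K q\<^sub>2)"
    if "liftable (class_K p\<^sub>1) (class_K p\<^sub>2)" "liftable (class_K q\<^sub>1) (class_K q\<^sub>2)" "cyclic_pair (lift_class True (class_K p\<^sub>1) (class_K p\<^sub>2)) (lift_class False (class_K q\<^sub>1) (class_K q\<^sub>2)) = c"
      "class_K q\<^sub>1 = - wclass w + class_K p\<^sub>1 + class_K q\<^sub>2 - class_K p\<^sub>1" "k \<in> set KL" for p\<^sub>1 p\<^sub>2 q\<^sub>1 q\<^sub>2 k
    using bspec[OF bspec[OF c' in_liftable_pairs[OF that(1)], unfolded prod.case] in_liftable_pairs[OF that(2)], unfolded prod.case] that(3-)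
    by simp
  have cyclic_pair_moves: "cyclic_pair x (y + x) = cyclic_pair x y" "cyclic_pair (x + y - x) (- x) = cyclic_pair x y" for x y
    using cyclic_pair_checks(1) in_allQ unfolding list_all_iff by blast+
  obtain p' q' where *: "p' \<in> G" "q' \<in> G" "comm p' q' = comm p q" "\<not> act q'" "cyclic_pair (class_K p') (class_K q') = c"
    by (rule commutator_inactive[OF p(1,2), of "\<lambda>x y. cyclic_pair x y = c"]) (simp_all only: cyclic_pair_moves cyclic_pair)
  have "comm p' q' = N False g\<^sub>1 g\<^sub>2" using * p(3) by simp
  from *(1,2) this *(4) show False
  proof (cases rule: commutator_states)
    case (inactive p\<^sub>1 p\<^sub>2 q\<^sub>1 q\<^sub>2)
    then have "possible (nu g\<^sub>1) (class_K p\<^sub>1) (class_K q\<^sub>1)" "possible (nu g\<^sub>2) (class_K p\<^sub>2) (class_K q\<^sub>2)" using possible_sound by auto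
    moreover have "comm (class_K p\<^sub>1) (class_K q\<^sub>1) = wclass w" "comm (class_K p\<^sub>2) (class_K q\<^sub>2) = wclass w'"
      using inactive(6,7) n(3,4) by (metis class_K_comm)+
    ultimately show False using chk[OF inactive(2,3)] inactive(4,5) *(5) n(1,2) by simp
  next
    case (active p\<^sub>1 p\<^sub>2 q\<^sub>1 q\<^sub>2)
    \<comment> \<open>The state \<open>p\<^sub>2\<close> is unknown, but its \<open>nu\<close> value
      is that of its coset representative up to an element of \<open>KL\<close>, over which
      \<open>excludes\<close> quantifies.\<close>
    define k where "k = p\<^sub>2 - rep (class_K p\<^sub>2)"
    have k: "nu k \<in> set KL" using G_rep[of p\<^sub>2] active(1) nu_K by (simp add: k_def)
    have p2: "nu p\<^sub>2 = nu k + nw (rep_word (class_K p\<^sub>2))"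
      by (simp add: k_def nu_plus[symmetric] nu_val[symmetric] val_rep_word)
    have "possible (nu (p\<^sub>2 + g\<^sub>1 - p\<^sub>2 + g\<^sub>2)) (class_K (p\<^sub>2 + p\<^sub>1)) (class_K q\<^sub>2)"
      using possible_sound[of "p\<^sub>2 + p\<^sub>1" q\<^sub>2] active(1) unfolding active(7) by simp
    then have "possible (nu k + nw (rep_word (class_K p\<^sub>2)) + nw w - (nu k + nw (rep_word (class_K p\<^sub>2))) + nw w') (class_K p\<^sub>2 + class_K p\<^sub>1) (class_K q\<^sub>2)"
      by (simp only: nu_plus nu_diff p2 n class_K_plus)
    then show False using chk'[OF active(2,3) _ _ k] active(4,5,6) *(5) n(3) by simp
  qed
qed

text \<open>
  If \<open>[p, q] = elA\<close>, then \<open>p\<close> and \<open>q\<close> generate a noncyclic subgroup of \<open>\<langle>a, d\<rangle>\<close>; if \<open>[p, q] = elB\<close>, a cyclic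
  one. Corresponding states generate isomorphic subgroups, so \<open>\<llangle>elA, elB\<rrangle>\<close> cannot be a commutator of
  elements that fix both subtrees. The pair was found by a computer search.
\<close>

definition wA1 :: word where "wA1 = [A,D,A,D]"
definition wA2 :: word where "wA2 = [A,C,A,B,A,B,A,C]"
definition wB1 :: word where "wB1 = [A,B,A,B,A,B,A,B]"
definition wB2 :: word where "wB2 = [A,C,A,C,A,C,A,C]"

definition elA :: aut where "elA = N False (val wA1) (val wA2)"
definition elB :: aut where "elB = N False (val wB1) (val wB2)"

lemma elA_elB_in_K: "elA \<in> K" "elB \<in> K"
  unfolding K_iff elA_def elB_def
  by (simp_all add: N_in_G class_K_N class_K_val wA1_def wA2_def wB1_def wB2_def zero_Q_def del: val.simps)

text \<open>
  Modulo the kernel of \<open>dat2\<close>, multiplication by \<open>elB\<close> permutes the 32 conjugates of \<open>elA\<close>. Hence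
  \<open>h elA h\<^sup>-\<^sup>1 elB\<close>, which occurs when one of \<open>p\<close> and \<open>q\<close> exchanges the subtrees, behaves like \<open>elA\<close>.
\<close>

definition dat :: "aut \<Rightarrow> nu \<times> Q" where "dat x = (nu x, class_K x)"

definition dat2 :: "aut \<Rightarrow> (nu \<times> Q) wr" where "dat2 x = Wr (act x) (dat (sec0 x)) (dat (sec1 x))"

lemma dat2_plus: "dat2 (x + y) = dat2 x + dat2 y"
  by (simp add: dat2_def dat_def act_plus sec0_plus sec1_plus nu_plus class_K_plus)

lemma dat2_0: "dat2 0 = 0"
  by (simp add: dat2_def dat_def zero_wr_def nu_0 zero_prod_def)

lemma dat2_uminus: "dat2 (- x) = - dat2 x"
  by (rule minus_unique[symmetric]) (simp add: dat2_plus[symmetric] dat2_0)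

lemma dat2_diff: "dat2 (x - y) = dat2 x - dat2 y"
  by (simp only: diff_conv_add_uminus dat2_plus dat2_uminus)

fun wdat :: "word \<Rightarrow> nu \<times> Q" where "wdat w = (nw w, wclass w)"

fun ldat2 :: "letter \<Rightarrow> (nu \<times> Q) wr" where
  "ldat2 A = Wr True 0 0" | "ldat2 B = Wr False (wdat [A]) (wdat [C])"
| "ldat2 C = Wr False (wdat [A]) (wdat [D])" | "ldat2 D = Wr False 0 (wdat [B])"

fun wdat2 :: "word \<Rightarrow> (nu \<times> Q) wr" where "wdat2 [] = 0" | "wdat2 (l # w) = ldat2 l + wdat2 w"

lemma dat_val: "dat (val w) = wdat w"
  by (simp add: dat_def nu_val class_K_val)

lemma dat2_lval: "dat2 (lval l) = ldat2 l"
proof -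
  have "dat 0 = 0" "dat gA = wdat [A]" "dat gB = wdat [B]" "dat gC = wdat [C]" "dat gD = wdat [D]"
    using dat_val[of "[]"] dat_val[of "[A]"] dat_val[of "[B]"] dat_val[of "[C]"] dat_val[of "[D]"]
    by (simp_all add: zero_prod_def)
  then show ?thesis by (cases l) (simp_all add: dat2_def gens_act gens_sec del: wdat.simps)
qed

lemma dat2_val: "dat2 (val w) = wdat2 w"
  by (induction w) (simp_all add: dat2_0 dat2_plus dat2_lval)

definition sA :: "(nu \<times> Q) wr" where "sA = Wr False (wdat wA1) (wdat wA2)"
definition sB :: "(nu \<times> Q) wr" where "sB = Wr False (wdat wB1) (wdat wB2)"

definition orbit :: "(nu \<times> Q) wr list" where
  "orbit = map (\<lambda>w. wdat2 w + sA - wdat2 w)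
    [[], [A], [B], [B,A], [A,B], [A,B,A], [B,A,B], [C,A,B], [D,A,B], [B,A,B,A], [C,A,B,A], [D,A,B,A], [A,B,A,B], [A,C,A,B], [A,B,A,B,A], [A,C,A,B,A], [B,A,B,A,B], [C,A,B,A,B], [D,A,B,A,B], [B,A,C,A,B], [B,A,B,A,B,A], [C,A,B,A,B,A], [D,A,B,A,B,A], [B,A,C,A,B,A], [A,B,A,B,A,B], [A,D,A,B,A,B], [A,B,A,C,A,B], [A,B,A,B,A,B,A], [A,D,A,B,A,B,A], [A,B,A,C,A,B,A], [B,A,B,A,B,A,B], [B,A,B,A,B,A,B,A]]"

lemma orbit_checks:
  "list_all (\<lambda>x. x + sB \<in> set orbit \<and> list_all (\<lambda>l. ldat2 l + x - ldat2 l \<in> set orbit) [A,B,C,D]) orbit"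
  "sA \<in> set orbit"
  by code_simp+

lemma dat2_elA: "dat2 elA = sA" and dat2_elB: "dat2 elB = sB"
  by (simp_all add: dat2_def elA_def elB_def sA_def sB_def dat_val del: wdat.simps)

lemma orbit_conj: "\<lbrakk>z \<in> G; dat2 h \<in> set orbit\<rbrakk> \<Longrightarrow> dat2 (z + h - z) \<in> set orbit"
proof (induction z arbitrary: h rule: G.induct)
  case (G_step z g)
  obtain l where g: "g = lval l" using G_step.hyps(2) by (metis empty_iff insert_iff lval.simps)
  have "ldat2 l + dat2 h - ldat2 l \<in> set orbit"
    using orbit_checks(1) G_step.prems unfolding list_all_iff by (cases l) auto
  then have "dat2 (g + h - g) \<in> set orbit" by (simp only: g dat2_plus dat2_diff dat2_lval)
  then have "dat2 (z + (g + h - g) - z) \<in> set orbit" by (rule G_step.IH)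
  moreover have "z + (g + h - g) - z = (z + g) + h - (z + g)" by (simp only: free_group)
  ultimately show ?case by simp
qed simp

text \<open>After conjugation \<open>h\<close> has the same \<open>dat2\<close> as
  \<open>elA\<close>, and \<open>excludes_elA\<close> sees nothing else. It demands a noncyclic
  pair, whereas rotations generate a cyclic group.\<close>

lemma orbit_not_commutator:
  assumes h: "dat2 h \<in> set orbit" and p: "p \<in> G" "q \<in> G" "rotation (class_K p)" "rotation (class_K q)"
  shows "comm p q \<noteq> h"
proof
  assume eq: "comm p q = h"
  obtain w where w: "dat2 h = wdat2 w + sA - wdat2 w" using h unfolding orbit_def set_map by blast
  define z where "z = - val w"
  have z: "z \<in> G" by (simp add: z_def)
  define h' where "h' = z + h - z"
  have "dat2 h' = - wdat2 w + (wdat2 w + sA - wdat2 w) - (- wdat2 w)"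
    by (simp only: h'_def z_def dat2_plus dat2_diff dat2_uminus dat2_val w)
  then have "dat2 h' = sA" by (simp only: free_group)
  then have a: "\<not> act h'" "dat (sec0 h') = wdat wA1" "dat (sec1 h') = wdat wA2" by (simp_all add: dat2_def sA_def)
  have "h' = comm (z + p - z) (z + q - z)" unfolding h'_def eq[symmetric] by (rule comm_conj)
  then have "comm (z + p - z) (z + q - z) = N False (sec0 h') (sec1 h')" using N_sec[of h'] a(1) by simp
  then have "\<not> cyclic_pair (class_K (z + p - z)) (class_K (z + q - z))"
    using check_sound[OF excludes_elA[folded wA1_def wA2_def], of "z + p - z" "z + q - z" "sec0 h'" "sec1 h'"] p z a(2,3)
    by (simp add: dat_def)
  moreover have "rotation (class_K (z + p - z))" "rotation (class_K (z + q - z))"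
    using cyclic_pair_checks(1) in_allQ p(3,4) unfolding list_all_iff class_K_plus class_K_diff by blast+
  ultimately show False using cyclic_pair_checks(1) in_allQ unfolding list_all_iff by blast
qed

text \<open>In the dihedral group q' is conjugate to its image under the swap of a and d. That
  automorphism exchanges the two classes of noncentral reflections, so q' is a rotation. It also
  preserves rotations, so p and p' are of the same kind and their product is a rotation.\<close>

lemma rotation_states:
  assumes "liftable p p'" "liftable q q'" "q = p + q' - p" shows "rotation (p' + p)" "rotation q'"
  using cyclic_pair_checks(2) in_liftable_pairs[OF assms(1)] in_liftable_pairs[OF assms(2)] assms(3) unfolding list_all_iff by fast+

theorem not_commutator_in_G:
  assumes "p \<in> G" "q \<in> G" shows "comm p q \<noteq> N False elA elB"
proof
  assume "comm p q = N False elA elB"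
  moreover obtain p' q' where "p' \<in> G" "q' \<in> G" "comm p' q' = comm p q" "\<not> act q'"
    using commutator_inactive[OF assms, of "\<lambda>_ _. True"] by blast
  ultimately have *: "p' \<in> G" "q' \<in> G" "comm p' q' = N False elA elB" "\<not> act q'" by simp_all
  then show False
  proof (cases rule: commutator_states)
    case (inactive p\<^sub>1 p\<^sub>2 q\<^sub>1 q\<^sub>2)
    then have "\<not> cyclic_pair (class_K p\<^sub>1) (class_K q\<^sub>1)" "cyclic_pair (class_K p\<^sub>2) (class_K q\<^sub>2)"
      using check_sound[OF excludes_elA[folded wA1_def wA2_def], of p\<^sub>1 q\<^sub>1 "val wA1" "val wA2"]
        check_sound[OF excludes_elB[folded wB1_def wB2_def], of p\<^sub>2 q\<^sub>2 "val wB1" "val wB2"]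
      by (simp_all add: elA_def elB_def nu_val class_K_val)
    moreover have "cyclic_pair (class_K p\<^sub>1) (class_K q\<^sub>1) = cyclic_pair (class_K p\<^sub>2) (class_K q\<^sub>2)"
      using cyclic_pair_checks(2) in_liftable_pairs[OF inactive(2)] in_liftable_pairs[OF inactive(3)] unfolding list_all_iff by fast
    ultimately show False by simp
  next
    case (active p\<^sub>1 p\<^sub>2 q\<^sub>1 q\<^sub>2)
    have "class_K q\<^sub>1 = class_K p\<^sub>1 + class_K q\<^sub>2 - class_K p\<^sub>1" using active(6) class_K_K[OF elA_elB_in_K(1)] by simp
    then have rotation: "rotation (class_K (p\<^sub>2 + p\<^sub>1))" "rotation (class_K q\<^sub>2)" using rotation_states[OF active(2,3)] by (simp_all add: class_K_plus)
    have "dat2 (p\<^sub>2 + elA - p\<^sub>2) \<in> set orbit" using orbit_conj[of p\<^sub>2 elA] active(1) orbit_checks(2) by (simp add: dat2_elA)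
    then have "dat2 (p\<^sub>2 + elA - p\<^sub>2 + elB) \<in> set orbit"
      using orbit_checks(1) unfolding list_all_iff dat2_plus[of _ elB] dat2_elB by blast
    then show False using orbit_not_commutator[of "p\<^sub>2 + elA - p\<^sub>2 + elB" "p\<^sub>2 + p\<^sub>1" q\<^sub>2] active(1,7) rotation by simp
  qed
qed

text \<open>The cyclic subgroup of order 4 generated by ca in G/K. It contains the classes of all
  states of elements of K (\<open>K_states\<close>).\<close>

definition C4 :: "Q list" where "C4 = map wclass [[], [C,A], [A,C,A,C], [A,C]]"

lemma C4_checks:
  "list_all (\<lambda>p. list_all (\<lambda>q. q + p \<in> set C4 \<and> p + q - p \<in> set C4 \<and> - p \<in> set C4) C4) C4"
  "list_all (\<lambda>(p, p'). lift_class False p p' \<in> set C4 \<longrightarrow> rotation p') liftable_pairs"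
  by code_simp+

text \<open>In both cases the equation for \<open>elA\<close> is left with rotations as entries: for
  inactive entries by the restriction to \<open>C4\<close>, otherwise by
  \<open>rotation_states\<close>.\<close>

theorem not_commutator_in_C4:
  assumes "p \<in> G" "q \<in> G" "class_K p \<in> set C4" "class_K q \<in> set C4" shows "comm p q \<noteq> N False 0 elA"
proof
  assume eq: "comm p q = N False 0 elA"
  define P where "P x y \<longleftrightarrow> x \<in> set C4 \<and> y \<in> set C4" for x y
  have "P x (y + x)" "P (x + y - x) (- x)" if "P x y" for x y
    using C4_checks(1) that unfolding list_all_iff P_def by blast+
  moreover have "P (class_K p) (class_K q)" using assms by (simp add: P_def)
  ultimately obtain p' q' where p': "p' \<in> G" "q' \<in> G" "comm p' q' = comm p q" "\<not> act q'" "P (class_K p') (class_K q')"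
    by (rule commutator_inactive[OF assms(1,2), of P])
  then have *: "p' \<in> G" "q' \<in> G" "comm p' q' = N False 0 elA" "\<not> act q'" "class_K p' \<in> set C4" "class_K q' \<in> set C4"
    using eq by (simp_all add: P_def)
  have A: "dat2 elA \<in> set orbit" using orbit_checks(2) by (simp add: dat2_elA)
  from *(1-4) show False
  proof (cases rule: commutator_states)
    case (inactive p\<^sub>1 p\<^sub>2 q\<^sub>1 q\<^sub>2)
    then have "rotation (class_K p\<^sub>2)" "rotation (class_K q\<^sub>2)"
      using C4_checks(2) in_liftable_pairs[OF inactive(2)] in_liftable_pairs[OF inactive(3)] *(5,6) unfolding list_all_iff by fastforce+
    then show False using orbit_not_commutator[OF A, of p\<^sub>2 q\<^sub>2] inactive by simp
  next
    case (active p\<^sub>1 p\<^sub>2 q\<^sub>1 q\<^sub>2)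
    have "class_K q\<^sub>1 = class_K p\<^sub>1 + class_K q\<^sub>2 - class_K p\<^sub>1" using active(6) by simp
    then have "rotation (class_K (p\<^sub>2 + p\<^sub>1))" "rotation (class_K q\<^sub>2)" using rotation_states[OF active(2,3)] by (simp_all add: class_K_plus)
    then show False using orbit_not_commutator[OF A, of "p\<^sub>2 + p\<^sub>1" q\<^sub>2] active(1,7) by simp
  qed
qed



section \<open>Commutator width\<close>

definition subgrp :: "aut set \<Rightarrow> bool" where
  "subgrp S \<longleftrightarrow> 0 \<in> S \<and> (\<forall>x\<in>S. \<forall>y\<in>S. x + y \<in> S) \<and> (\<forall>x\<in>S. - x \<in> S)"

definition grp :: "aut set \<Rightarrow> (vertex \<Rightarrow> vertex) monoid" where
  "grp S = aut_T2\<lparr>carrier := fun_of ` S\<rparr>"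

lemma subgrpD: "subgrp S \<Longrightarrow> 0 \<in> S" "\<lbrakk>subgrp S; x \<in> S; y \<in> S\<rbrakk> \<Longrightarrow> x + y \<in> S" "\<lbrakk>subgrp S; x \<in> S\<rbrakk> \<Longrightarrow> - x \<in> S"
  by (auto simp: subgrp_def)

lemma subgroup_fun_of:
  assumes "subgrp S" shows "subgroup (fun_of ` S) aut_T2"
proof (rule group.subgroupI[OF group_aut_T2])
  show "fun_of ` S \<subseteq> carrier aut_T2" using fun_of by blast
  show "fun_of ` S \<noteq> {}" using subgrpD(1)[OF assms] by blast
  show "inv\<^bsub>aut_T2\<^esub> h \<in> fun_of ` S" if "h \<in> fun_of ` S" for h
    using that subgrpD(3)[OF assms] by (auto simp: fun_of_uminus[symmetric])
  show "h \<otimes>\<^bsub>aut_T2\<^esub> k \<in> fun_of ` S" if "h \<in> fun_of ` S" "k \<in> fun_of ` S" for h k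
    using that subgrpD(2)[OF assms] by (auto simp: fun_of_plus[symmetric])
qed

lemma grp_mult: "fun_of x \<otimes>\<^bsub>grp S\<^esub> fun_of y = fun_of (x + y)"
  and grp_one: "\<one>\<^bsub>grp S\<^esub> = fun_of 0"
  and grp_carrier: "carrier (grp S) = fun_of ` S"
  by (simp_all add: grp_def fun_of_plus fun_of_0)

lemma grp_inv: "\<lbrakk>subgrp S; x \<in> S\<rbrakk> \<Longrightarrow> inv\<^bsub>grp S\<^esub> (fun_of x) = fun_of (- x)"
  unfolding grp_def fun_of_uminus
  by (rule group.m_inv_consistent[OF group_aut_T2 subgroup_fun_of]) auto

lemma grp_derived_set:
  assumes "subgrp S"
  shows "derived_set (grp S) (carrier (grp S)) = {fun_of (comm x y) | x y. x \<in> S \<and> y \<in> S}"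
proof -
  have "fun_of x \<otimes>\<^bsub>grp S\<^esub> fun_of y \<otimes>\<^bsub>grp S\<^esub> inv\<^bsub>grp S\<^esub> (fun_of x) \<otimes>\<^bsub>grp S\<^esub> inv\<^bsub>grp S\<^esub> (fun_of y) = fun_of (comm x y)"
    if "x \<in> S" "y \<in> S" for x y
    using that assms by (simp add: grp_inv grp_mult comm_def diff_conv_add_uminus del: add_uminus_conv_diff)
  then show ?thesis by (auto simp: grp_carrier)
qed

lemma grp_derived:
  assumes S: "subgrp S" and E: "subgrp E" "\<And>x y. \<lbrakk>x \<in> S; y \<in> S\<rbrakk> \<Longrightarrow> comm x y \<in> E" "E \<subseteq> S"
  shows "derived (grp S) (carrier (grp S)) \<subseteq> fun_of ` E"
proof
  fix h assume "h \<in> derived (grp S) (carrier (grp S))"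
  then show "h \<in> fun_of ` E"
    unfolding derived_def
  proof (induction rule: generate.induct)
    case one
    then show ?case using subgrpD(1)[OF E(1)] by (auto simp: grp_one)
  next
    case (incl h)
    then show ?case using E(2) by (auto simp: grp_derived_set[OF S])
  next
    case (inv h)
    then obtain x y where xy: "h = fun_of (comm x y)" "x \<in> S" "y \<in> S" by (auto simp: grp_derived_set[OF S])
    then have "comm x y \<in> E" "comm x y \<in> S" using E by auto
    then show ?case using subgrpD(3)[OF E(1)] by (auto simp: xy(1) grp_inv[OF S])
  next
    case (eng h k)
    then show ?case using subgrpD(2)[OF E(1)] by (auto simp: grp_mult)
  qed
qed

text \<open>\<open>E\<close> is only assumed to contain the commutators; the hypothesis
  \<open>two\<close> supplies the upper bound and also places the witness \<open>g\<close> in the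
  derived subgroup.\<close>

lemma commutator_width_two:
  assumes S: "subgrp S" and E: "subgrp E" "\<And>x y. \<lbrakk>x \<in> S; y \<in> S\<rbrakk> \<Longrightarrow> comm x y \<in> E" "E \<subseteq> S"
    and two: "\<And>g. g \<in> E \<Longrightarrow> \<exists>x\<in>S. \<exists>y\<in>S. \<exists>u\<in>S. \<exists>v\<in>S. g = comm x y + comm u v"
    and g: "g \<in> E" "\<And>x y. \<lbrakk>x \<in> S; y \<in> S\<rbrakk> \<Longrightarrow> comm x y \<noteq> g"
  shows "commutator_width (grp S) = 2"
proof -
  let ?\<Gamma> = "grp S"
  define W where "W = {enat n | n. derived ?\<Gamma> (carrier ?\<Gamma>) \<subseteq> commutator_products ?\<Gamma> n}"
  have "derived ?\<Gamma> (carrier ?\<Gamma>) \<subseteq> commutator_products ?\<Gamma> 2"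
  proof
    fix h assume "h \<in> derived ?\<Gamma> (carrier ?\<Gamma>)"
    then obtain k where "h = fun_of k" "k \<in> E" using grp_derived[OF S E] by blast
    then obtain x y u v where *: "x \<in> S" "y \<in> S" "u \<in> S" "v \<in> S" "h = fun_of (comm x y + comm u v)" using two by blast
    have "h = foldr (\<otimes>\<^bsub>?\<Gamma>\<^esub>) [fun_of (comm x y), fun_of (comm u v)] \<one>\<^bsub>?\<Gamma>\<^esub>"
      by (simp add: grp_one grp_mult *(5))
    moreover have "set [fun_of (comm x y), fun_of (comm u v)] \<subseteq> derived_set ?\<Gamma> (carrier ?\<Gamma>)"
      using * by (auto simp: grp_derived_set[OF S])
    ultimately show "h \<in> commutator_products ?\<Gamma> 2"
      unfolding commutator_products_def by (intro CollectI exI[of _ "[fun_of (comm x y), fun_of (comm u v)]"]) simp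
  qed
  then have "2 \<in> W" unfolding W_def by (metis (mono_tags, lifting) mem_Collect_eq numeral_eq_enat)
  moreover have "2 \<le> w" if w: "w \<in> W" for w
  proof -
    obtain n where n: "w = enat n" "derived ?\<Gamma> (carrier ?\<Gamma>) \<subseteq> commutator_products ?\<Gamma> n"
      using w unfolding W_def by blast
    obtain x y u v where g': "x \<in> S" "y \<in> S" "u \<in> S" "v \<in> S" "g = comm x y + comm u v" using two[OF g(1)] by blast
    then have "fun_of (comm x y) \<otimes>\<^bsub>?\<Gamma>\<^esub> fun_of (comm u v) \<in> derived ?\<Gamma> (carrier ?\<Gamma>)"
      unfolding derived_def by (intro generate.eng generate.incl) (auto simp: grp_derived_set[OF S])
    then have "fun_of g \<in> commutator_products ?\<Gamma> n" using n(2) g'(5) by (auto simp: grp_mult)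
    then obtain cs where cs: "fun_of g = foldr (\<otimes>\<^bsub>?\<Gamma>\<^esub>) cs \<one>\<^bsub>?\<Gamma>\<^esub>" "length cs = n"
      "set cs \<subseteq> derived_set ?\<Gamma> (carrier ?\<Gamma>)" by (auto simp: commutator_products_def)
    have "n \<noteq> 0"
    proof
      assume "n = 0"
      then have "g = 0" using cs by (simp add: grp_one fun_of_inject)
      moreover have "comm 0 0 = (0 :: aut)" by (simp add: comm_def)
      ultimately show False using g(2)[of 0 0] subgrpD(1)[OF S] by simp
    qed
    moreover have "n \<noteq> 1"
    proof
      assume "n = 1"
      then obtain c where "cs = [c]" using cs(2) by (auto simp: length_Suc_conv)
      then obtain p q where "p \<in> S" "q \<in> S" "fun_of g = fun_of (comm p q + 0)"
        using cs by (auto simp: grp_derived_set[OF S] grp_one grp_mult)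
      then show False using g(2)[of p q] by (simp add: fun_of_inject)
    qed
    ultimately have "2 \<le> n" by simp
    then show ?thesis by (simp add: n(1) numeral_eq_enat)
  qed
  ultimately have "Inf W = 2" by (intro antisym Inf_lower Inf_greatest)
  then show ?thesis by (simp add: commutator_width_def W_def)
qed

lemma subgrp_G: "subgrp G"
  by (simp add: subgrp_def)

lemma subgrp_K: "subgrp K"
  by (simp add: subgrp_def K_plus K_uminus zero_in_K)

lemma grigorchuk_group_eq: "grigorchuk_group = grp G"
proof -
  interpret group aut_T2 by (rule group_aut_T2)
  let ?X = "{grig_a, grig_b, grig_c, grig_d}"
  have "fun_of ` G = generate aut_T2 ?X"
  proof (intro subset_antisym subsetI)
    fix h assume "h \<in> fun_of ` G"
    then obtain x where x: "h = fun_of x" "x \<in> G" by blast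
    have "fun_of x \<in> generate aut_T2 ?X"
      using x(2)
    proof induction
      case zero_in_G
      show ?case unfolding fun_of_0 by (rule generate.one)
    next
      case (G_step x g)
      show ?case unfolding fun_of_plus
        by (rule generate.eng[OF G_step.IH generate.incl]) (use G_step.hyps in auto)
    qed
    then show "h \<in> generate aut_T2 ?X" by (simp add: x(1))
  next
    fix h assume "h \<in> generate aut_T2 ?X"
    then show "h \<in> fun_of ` G"
    proof induction
      case one
      show ?case unfolding fun_of_0[symmetric] by simp
    next
      case (incl h)
      then have "h \<in> fun_of ` {gA, gB, gC, gD}" by auto
      then obtain x where "h = fun_of x" "x \<in> {gA, gB, gC, gD}" by blast
      then show ?case by (intro image_eqI[of _ _ x]) auto
    next
      case (inv h)
      then have "h \<in> fun_of ` {gA, gB, gC, gD}" by auto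
      then obtain x where "h = fun_of x" "x \<in> {gA, gB, gC, gD}" by blast
      then show ?case by (intro image_eqI[of _ _ "- x"]) (auto simp: fun_of_uminus)
    next
      case (eng h k)
      then show ?case by (auto simp: fun_of_plus[symmetric])
    qed
  qed
  then show ?thesis by (simp add: grigorchuk_group_def grp_def)
qed

lemma grig_K_eq: "grig_K = fun_of ` K"
proof -
  let ?\<Gamma> = "grp G"
  let ?X = "{g \<otimes>\<^bsub>?\<Gamma>\<^esub> s \<otimes>\<^bsub>?\<Gamma>\<^esub> inv\<^bsub>?\<Gamma>\<^esub> g | g s. g \<in> carrier ?\<Gamma> \<and>
       s \<in> {(grig_a \<otimes>\<^bsub>?\<Gamma>\<^esub> grig_b) [^]\<^bsub>?\<Gamma>\<^esub> (2::nat)}}"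
  have "grig_a \<otimes>\<^bsub>?\<Gamma>\<^esub> grig_b = fun_of (gA + gB)" using grp_mult[where S = G and x = gA and y = gB] by simp
  then have "(grig_a \<otimes>\<^bsub>?\<Gamma>\<^esub> grig_b) [^]\<^bsub>?\<Gamma>\<^esub> (2::nat) = fun_of t_elt"
    by (simp add: numeral_2_eq_2 nat_pow_def grp_one grp_mult t_elt_def add.assoc)
  then have "?X = (\<lambda>g. g \<otimes>\<^bsub>?\<Gamma>\<^esub> fun_of t_elt \<otimes>\<^bsub>?\<Gamma>\<^esub> inv\<^bsub>?\<Gamma>\<^esub> g) ` fun_of ` G"
    by (auto simp: grp_carrier)
  also have "\<dots> = (\<lambda>g. fun_of (g + t_elt - g)) ` G"
    unfolding image_image
    by (intro image_cong refl) (simp add: grp_mult grp_inv[OF subgrp_G] diff_conv_add_uminus del: add_uminus_conv_diff)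
  also have "\<dots> = {fun_of (g + t_elt - g) | g. g \<in> G}" by blast
  finally have X: "?X = {fun_of (g + t_elt - g) | g. g \<in> G}" .
  have "grig_K = generate ?\<Gamma> {fun_of (g + t_elt - g) | g. g \<in> G}"
    unfolding grig_K_def normal_closure_def grigorchuk_group_eq X ..
  also have "\<dots> = fun_of ` K"
  proof (intro subset_antisym subsetI)
    fix h assume "h \<in> fun_of ` K"
    then obtain x where x: "h = fun_of x" "x \<in> K" by blast
    have "fun_of x \<in> generate ?\<Gamma> {fun_of (g + t_elt - g) | g. g \<in> G}"
      using x(2)
    proof induction
      case zero_in_K
      show ?case using generate.one[of ?\<Gamma>] by (simp add: grp_one)
    next
      case (K_step k g)
      show ?case unfolding grp_mult[where S = G, symmetric]
        by (rule generate.eng[OF K_step.IH generate.incl]) (use K_step.hyps in auto)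
    qed
    then show "h \<in> generate ?\<Gamma> {fun_of (g + t_elt - g) | g. g \<in> G}" by (simp add: x(1))
  next
    fix h assume "h \<in> generate ?\<Gamma> {fun_of (g + t_elt - g) | g. g \<in> G}"
    then show "h \<in> fun_of ` K"
    proof induction
      case one
      show ?case unfolding grp_one using zero_in_K by blast
    next
      case (incl h)
      then show ?case using t_elt_in_K by auto
    next
      case (inv h)
      then obtain g where g: "h = fun_of (g + t_elt - g)" "g \<in> G" by blast
      then have "inv\<^bsub>?\<Gamma>\<^esub> h = fun_of (- (g + t_elt - g))" by (simp only: grp_inv[OF subgrp_G] G_plus G_diff t_elt_in_G)
      then show ?case using K_uminus[OF t_elt_in_K[OF g(2)]] by blast
    next
      case (eng h k)
      then show ?case by (auto simp: grp_mult intro: K_plus)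
    qed
  qed
  finally show ?thesis .
qed

lemma grig_K_group_eq: "grigorchuk_group\<lparr>carrier := grig_K\<rparr> = grp K"
  by (simp add: grigorchuk_group_def grp_def grig_K_eq)

section \<open>Commutators of elements of K lie in K x K x K x K\<close>

definition qstates :: "aut \<Rightarrow> Q wr" where "qstates x = Wr (act x) (class_K (sec0 x)) (class_K (sec1 x))"

lemma qstates_plus: "qstates (x + y) = qstates x + qstates y"
  by (simp add: qstates_def act_plus sec0_plus sec1_plus class_K_plus)

lemma qstates_uminus: "qstates (- x) = - qstates x"
  by (simp add: qstates_def act_uminus sec0_uminus sec1_uminus class_K_uminus)

definition C4_states :: "Q wr list" where
  "C4_states = concat (map (\<lambda>(p, p'). concat (map (\<lambda>s. if lift_class s p p' \<in> set C4 then [Wr s p p'] else [])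
     [False, True])) liftable_pairs)"

lemma C4_states_commute:
  "list_all (\<lambda>x. list_all (\<lambda>y. comm x y = 0) C4_states)
     C4_states"
  by code_simp

text \<open>The preimage of \<open>C4\<close> in G is abelian modulo K x K. Applied to both states
  of elements of K, this puts their commutators into K x K x K x K.\<close>

lemma comm_C4:
  assumes "x \<in> G" "y \<in> G" "class_K x \<in> set C4" "class_K y \<in> set C4"
  shows "\<exists>k\<in>K. \<exists>l\<in>K. comm x y = N False k l"
proof -
  have mem: "qstates x \<in> set C4_states"
    if x: "x \<in> G" "class_K x \<in> set C4" for x
  proof -
    obtain s y z where "x = N s y z" "liftable (class_K y) (class_K z)" "class_K x = lift_class s (class_K y) (class_K z)" using G_cases[OF x(1)] by metis
    then show ?thesis using in_liftable_pairs[of "class_K y" "class_K z"] x(2) by (cases s) (force simp: qstates_def C4_states_def)+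
  qed
  have "comm (qstates x) (qstates y) = 0"
    using C4_states_commute mem[OF assms(1,3)] mem[OF assms(2,4)] unfolding list_all_iff by blast
  then have "qstates (comm x y) = 0"
    unfolding comm_def diff_conv_add_uminus by (simp only: qstates_plus qstates_uminus)
  then have *: "\<not> act (comm x y)" "class_K (sec0 (comm x y)) = 0" "class_K (sec1 (comm x y)) = 0"
    by (simp_all add: qstates_def zero_wr_def)
  moreover have "comm x y \<in> G" using assms by simp
  ultimately have "sec0 (comm x y) \<in> K" "sec1 (comm x y) \<in> K" using G_states by (simp_all add: K_iff)
  moreover have "comm x y = N False (sec0 (comm x y)) (sec1 (comm x y))" using N_sec[of "comm x y"] *(1) by simp
  ultimately show ?thesis by blast
qed

lemma N_K_K: "\<lbrakk>x \<in> K; y \<in> K\<rbrakk> \<Longrightarrow> N False x y \<in> K"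
  by (simp add: K_iff N_in_G class_K_N liftable_0) (simp add: zero_Q_def)

theorem K_width: "commutator_width (grp K) = 2"
proof (rule commutator_width_two[OF subgrp_K])
  define E where "E = {N False (N False x y) (N False u v) | x y u v. x \<in> K \<and> y \<in> K \<and> u \<in> K \<and> v \<in> K}"
  show "subgrp E"
    unfolding subgrp_def
  proof (intro conjI ballI)
    show "0 \<in> E" unfolding E_def using zero_in_K N_zero by force
    show "x + y \<in> E" if "x \<in> E" "y \<in> E" for x y
      using that unfolding E_def by (clarsimp simp: N_plus) (blast intro: K_plus)
    show "- x \<in> E" if "x \<in> E" for x
      using that unfolding E_def by (clarsimp simp: N_uminus) (blast intro: K_uminus)
  qed
  show "comm x y \<in> E" if xy: "x \<in> K" "y \<in> K" for x y
  proof -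
    have states: "\<exists>x\<^sub>1 x\<^sub>2. x = N False x\<^sub>1 x\<^sub>2 \<and> x\<^sub>1 \<in> G \<and> x\<^sub>2 \<in> G \<and> class_K x\<^sub>1 \<in> set C4 \<and> class_K x\<^sub>2 \<in> set C4"
      if x: "x \<in> K" for x
    proof -
      obtain x\<^sub>1 x\<^sub>2 u\<^sub>1 u\<^sub>2 where "x = N False x\<^sub>1 x\<^sub>2" "x\<^sub>1 \<in> G" "x\<^sub>2 \<in> G" "class_K x\<^sub>1 = wclass u\<^sub>1" "class_K x\<^sub>2 = wclass u\<^sub>2"
        "(odd_class x, u\<^sub>1, u\<^sub>2) \<in> set K_states" using K_cases[OF x] .
      moreover then have "wclass u\<^sub>1 \<in> set C4 \<and> wclass u\<^sub>2 \<in> set C4" by (auto simp: K_states_def C4_def)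
      ultimately show ?thesis by auto
    qed
    obtain x\<^sub>1 x\<^sub>2 where x: "x = N False x\<^sub>1 x\<^sub>2" "x\<^sub>1 \<in> G" "x\<^sub>2 \<in> G" "class_K x\<^sub>1 \<in> set C4" "class_K x\<^sub>2 \<in> set C4"
      using states[OF xy(1)] by blast
    obtain y\<^sub>1 y\<^sub>2 where y: "y = N False y\<^sub>1 y\<^sub>2" "y\<^sub>1 \<in> G" "y\<^sub>2 \<in> G" "class_K y\<^sub>1 \<in> set C4" "class_K y\<^sub>2 \<in> set C4"
      using states[OF xy(2)] by blast
    show ?thesis
      using comm_C4[OF x(2) y(2) x(4) y(4)] comm_C4[OF x(3) y(3) x(5) y(5)]
      unfolding E_def x(1) y(1) comm_N_inactive by fastforce
  qed
  show "E \<subseteq> K" unfolding E_def by (auto intro: N_K_K)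
  show "\<exists>x\<in>K. \<exists>y\<in>K. \<exists>u\<in>K. \<exists>v\<in>K. g = comm x y + comm u v" if g: "g \<in> E" for g
  proof -
    obtain x y u v where "g = N False (N False x y) (N False u v)" "x \<in> K" "y \<in> K" "u \<in> K" "v \<in> K"
      using g by (auto simp: E_def)
    then have "g \<in> constrained [(0, 0), (0, 0)]" by (simp add: K4_two_commutators)
    then obtain x y u v where "g = comm x y + (comm u v + 0)" "x \<in> K" "y \<in> K" "u \<in> K" "v \<in> K"
      by (elim constrained_ConsE) (auto simp: K_iff)
    then show ?thesis by auto
  qed
  \<comment> \<open>The witness puts its obstruction in the first state, where the entries are
    confined to \<open>C4\<close> and \<open>not_commutator_in_C4\<close> applies.\<close>
  show "N False (N False 0 elA) (N False 0 0) \<in> E"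
    unfolding E_def using zero_in_K elA_elB_in_K(1) by blast
  show "comm x y \<noteq> N False (N False 0 elA) (N False 0 0)" if xy: "x \<in> K" "y \<in> K" for x y
  proof
    assume eq: "comm x y = N False (N False 0 elA) (N False 0 0)"
    obtain x\<^sub>1 x\<^sub>2 u\<^sub>1 u\<^sub>2 where x: "x = N False x\<^sub>1 x\<^sub>2" "x\<^sub>1 \<in> G" "x\<^sub>2 \<in> G" "class_K x\<^sub>1 = wclass u\<^sub>1" "class_K x\<^sub>2 = wclass u\<^sub>2"
      "(odd_class x, u\<^sub>1, u\<^sub>2) \<in> set K_states" using K_cases[OF xy(1)] .
    obtain y\<^sub>1 y\<^sub>2 v\<^sub>1 v\<^sub>2 where y: "y = N False y\<^sub>1 y\<^sub>2" "y\<^sub>1 \<in> G" "y\<^sub>2 \<in> G" "class_K y\<^sub>1 = wclass v\<^sub>1" "class_K y\<^sub>2 = wclass v\<^sub>2"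
      "(odd_class y, v\<^sub>1, v\<^sub>2) \<in> set K_states" using K_cases[OF xy(2)] .
    have "wclass u\<^sub>1 \<in> set C4" "wclass v\<^sub>1 \<in> set C4" using x(6) y(6) by (auto simp: K_states_def C4_def)
    moreover have "comm x\<^sub>1 y\<^sub>1 = N False 0 elA" using eq unfolding x(1) y(1) comm_N_inactive by simp
    ultimately show False using not_commutator_in_C4[of x\<^sub>1 y\<^sub>1] x y by simp
  qed
qed

theorem G_width: "commutator_width (grp G) = 2"
proof (rule commutator_width_two[OF subgrp_G])
  define E where "E = {x \<in> G. class_K x = 0 \<or> class_K x = wclass [A,D,A,D]}"
  have z: "wclass [A,D,A,D] = Q False True True False" by (simp add: zero_Q_def)
  show "subgrp E"
    unfolding subgrp_def E_def z by (auto simp: class_K_plus class_K_uminus zero_Q_def)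
  show "comm x y \<in> E" if "x \<in> G" "y \<in> G" for x y
    unfolding E_def z using that
    by (cases "class_K x"; cases "class_K y") (auto simp: class_K_comm comm_Q Let_def zero_Q_def)
  show "E \<subseteq> G" by (auto simp: E_def)
  show "\<exists>x\<in>G. \<exists>y\<in>G. \<exists>u\<in>G. \<exists>v\<in>G. g = comm x y + comm u v" if g: "g \<in> E" for g
  proof -
    obtain p q p' q' where "g \<in> constrained [(p, q), (p', q')]" using G_two_commutators g unfolding E_def by blast
    then obtain x y u v where "g = comm x y + (comm u v + 0)" "x \<in> G" "y \<in> G" "u \<in> G" "v \<in> G"
      by (elim constrained_ConsE) auto
    then show ?thesis by auto
  qed
  show "N False elA elB \<in> E"
    using N_K_K[OF elA_elB_in_K] by (simp add: E_def K_iff)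
  show "comm x y \<noteq> N False elA elB" if "x \<in> G" "y \<in> G" for x y
    using that by (rule not_commutator_in_G)
qed

theorem theoremA:
  shows "commutator_width grigorchuk_group = 2
    \<and> commutator_width (grigorchuk_group\<lparr>carrier := grig_K\<rparr>) = 2"
  unfolding grig_K_group_eq unfolding grigorchuk_group_eq using G_width K_width ..

end
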